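(* Let $\mathcal{H}$ be a complex reproducing kernel Hilbert space on a non-empty set $\Omega$, let $n\geq 1$ be an integer and let $A_i,B_i,X_i\in\mathcal{B}(\mathcal{H})$ for $i=1,2,\ldots,n$. Let $f$ and $g$ be two nonnegative continuous functions on $[0,\infty)$ satisfying $f(t)g(t)=t$ for all $t\in[0,\infty)$. Then for $\nu\in(0,1)$ and all $r\geq 2\max\{\nu,1-\nu\}$, $$\mathbf{ber}^r\left(\sum_{i=1}^{n}A_i^*X_iB_i\right)\leq \sqrt{2}\,n^{r-1}\,\mathbf{ber}\left(\sum_{i=1}^{n}\left(\nu\left[B_i^*f^2(|X_i|)B_i\right]^{\frac{r}{2\nu}}+\mathrm{i}(1-\nu)\left[A_i^*g^2(|X_i^*|)A_i\right]^{\frac{r}{2(1-\nu)}}\right)\right).$$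
   Context: Let $\Omega$ be a non-empty set. A complex reproducing kernel Hilbert space $\mathcal{H}$ on $\Omega$ is a complex Hilbert space consisting of functions $\Omega\to\mathbb{C}$ such that every evaluation $f\mapsto f(\lambda)$, $\lambda\in\Omega$, is bounded. For $\lambda\in\Omega$, $k_\lambda\in\mathcal{H}$ is the unique vector with $f(\lambda)=\langle f,k_\lambda\rangle$ for all $f\in\mathcal{H}$; it is assumed that $k_\lambda\neq 0$ for every $\lambda$, and $\hat{k}_\lambda=k_\lambda/\|k_\lambda\|$. $\mathcal{B}(\mathcal{H})$ is the set of bounded linear operators on $\mathcal{H}$. The Berezin number of $A\in\mathcal{B}(\mathcal{H})$ is $\mathbf{ber}(A)=\sup_{\lambda\in\Omega}|\langle A\hat{k}_\lambda,\hat{k}_\lambda\rangle|$, and $\mathbf{ber}^{s}(A)$ means $(\mathbf{ber}(A))^{s}$. $|A|=(A^*A)^{1/2}$ and $|A^*|=(AA^* )^{1/2}$; functions and real powers of positive operators are taken by the continuous functional calculus, and $f^2(|X|)=(f(|X|))^2$. $\mathrm{i}$ is the imaginary unit. *)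

theory Defs
  imports "HOL-Analysis.Analysis" "HOL-Computational_Algebra.Polynomial"
begin

text \<open>
  Complex inner product spaces, linear in the first argument. The real inner product inherited from
  \<^class>\<open>real_inner\<close> is the real part of the complex one, so that
  the norm is \<open>norm x = sqrt (Re (cinner x x))\<close>; positive definiteness of \<open>cinner\<close>
  follows from this, because \<open>cinner x x\<close> is real by conjugate symmetry.
\<close>

class complex_inner = real_inner +
  fixes scaleC :: "complex \<Rightarrow> 'a \<Rightarrow> 'a" (infixr "*\<^sub>C" 75)
    and cinner :: "'a \<Rightarrow> 'a \<Rightarrow> complex"
  assumes scaleC_add_right: "c *\<^sub>C (x + y) = c *\<^sub>C x + c *\<^sub>C y"
    and scaleC_add_left: "(c + d) *\<^sub>C x = c *\<^sub>C x + d *\<^sub>C x"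
    and scaleC_scaleC: "c *\<^sub>C d *\<^sub>C x = (c * d) *\<^sub>C x"
    and scaleR_scaleC: "r *\<^sub>R x = complex_of_real r *\<^sub>C x"
    and cinner_commute: "cinner x y = cnj (cinner y x)"
    and cinner_add_left: "cinner (x + y) z = cinner x z + cinner y z"
    and cinner_scaleC_left: "cinner (c *\<^sub>C x) y = c * cinner x y"
    and inner_eq_Re_cinner: "inner x y = Re (cinner x y)"

class chilbert_space = complex_inner + complete_space

instantiation complex :: chilbert_space
begin

definition scaleC_complex :: "complex \<Rightarrow> complex \<Rightarrow> complex"
  where "scaleC_complex c z = c * z"

definition cinner_complex :: "complex \<Rightarrow> complex \<Rightarrow> complex"
  where "cinner_complex x y = x * cnj y"

instance
  by standard (simp_all add: scaleC_complex_def cinner_complex_def algebra_simps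
      inner_complex_def scaleR_conv_of_real)

end

definition bounded_clinear :: "('a::complex_inner \<Rightarrow> 'b::complex_inner) \<Rightarrow> bool"
  where "bounded_clinear T \<longleftrightarrow> bounded_linear T \<and> (\<forall>c x. T (c *\<^sub>C x) = c *\<^sub>C T x)"

definition cadjoint :: "('h::chilbert_space \<Rightarrow> 'h) \<Rightarrow> 'h \<Rightarrow> 'h"
  where "cadjoint T = (THE S. \<forall>x y. cinner (T x) y = cinner x (S y))"

definition op_spectrum :: "('h::chilbert_space \<Rightarrow> 'h) \<Rightarrow> complex set"
  where "op_spectrum T = {z. \<not> (\<exists>S. bounded_clinear S \<and>
    (\<forall>x. S (T x - z *\<^sub>C x) = x) \<and> (\<forall>x. T (S x) - z *\<^sub>C S x = x))}"

definition poly_op :: "real poly \<Rightarrow> ('h::chilbert_space \<Rightarrow> 'h) \<Rightarrow> 'h \<Rightarrow> 'h"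
  where "poly_op p T = (\<lambda>x. \<Sum>j\<le>degree p. coeff p j *\<^sub>R (T ^^ j) x)"

text \<open>
  Continuous functional calculus for a self-adjoint operator \<open>T\<close> (whose spectrum is real) and a
  real function \<open>f\<close> continuous on the spectrum: \<open>cfc f T\<close> is the limit in operator norm of
  \<open>p\<^sub>m(T)\<close> for all real polynomials \<open>p\<^sub>m\<close> that converge to \<open>f\<close> uniformly on the spectrum.
  The value is meaningless if \<open>T\<close> is not self-adjoint or \<open>f\<close> is not continuous there.
\<close>

definition cfc :: "(real \<Rightarrow> real) \<Rightarrow> ('h::chilbert_space \<Rightarrow> 'h) \<Rightarrow> 'h \<Rightarrow> 'h"
  where "cfc f T = (THE S. bounded_clinear S \<and>
    (\<forall>p :: nat \<Rightarrow> real poly.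
      uniform_limit {t. complex_of_real t \<in> op_spectrum T} (\<lambda>m. poly (p m)) f sequentially \<longrightarrow>
      (\<lambda>m. onorm (\<lambda>x. poly_op (p m) T x - S x)) \<longlonglongrightarrow> 0))"

text \<open>Since \<open>0 powr a = 0\<close>, the function \<open>t powr a\<close> is the usual continuous power on
  the half-line \<open>t \<ge> 0\<close> for every \<open>a > 0\<close>.\<close>

definition op_powr :: "('h::chilbert_space \<Rightarrow> 'h) \<Rightarrow> real \<Rightarrow> 'h \<Rightarrow> 'h"
  where "op_powr T a = cfc (\<lambda>t. t powr a) T"

definition op_abs :: "('h::chilbert_space \<Rightarrow> 'h) \<Rightarrow> 'h \<Rightarrow> 'h"
  where "op_abs T = op_powr (cadjoint T \<circ> T) (1/2)"

text \<open>
  A Hilbert space of functions on \<open>\<Omega>\<close> is a Hilbert space \<open>'h\<close> together with the map \<open>ev\<close>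
  that sends a vector to the function it is. As two vectors are equal iff they are
  equal as functions on \<open>\<Omega>\<close>, \<open>ev\<close> is required to be injective; values \<open>ev h w\<close> with
  \<open>w \<notin> \<Omega>\<close> carry no information. Complex linearity of each evaluation says that the vector
  space operations are the pointwise ones.
\<close>

definition rep_kernel :: "('h::chilbert_space \<Rightarrow> 'w \<Rightarrow> complex) \<Rightarrow> 'w \<Rightarrow> 'h"
  where "rep_kernel ev w = (THE k. \<forall>h. ev h w = cinner h k)"

locale rkhs =
  fixes \<Omega> :: "'w set" and ev :: "'h::chilbert_space \<Rightarrow> 'w \<Rightarrow> complex"
  assumes nonempty: "\<Omega> \<noteq> {}"
    and ev_inject: "(\<And>w. w \<in> \<Omega> \<Longrightarrow> ev h w = ev h' w) \<Longrightarrow> h = h'"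
    and bounded_clinear_ev: "w \<in> \<Omega> \<Longrightarrow> bounded_clinear (\<lambda>h. ev h w)"
    and rep_kernel_nonzero: "w \<in> \<Omega> \<Longrightarrow> rep_kernel ev w \<noteq> 0"

definition normalized_kernel :: "('h::chilbert_space \<Rightarrow> 'w \<Rightarrow> complex) \<Rightarrow> 'w \<Rightarrow> 'h"
  where "normalized_kernel ev w = rep_kernel ev w /\<^sub>R norm (rep_kernel ev w)"

definition ber :: "'w set \<Rightarrow> ('h::chilbert_space \<Rightarrow> 'w \<Rightarrow> complex) \<Rightarrow> ('h \<Rightarrow> 'h) \<Rightarrow> real"
  where "ber \<Omega> ev T =
    (SUP w\<in>\<Omega>. cmod (cinner (T (normalized_kernel ev w)) (normalized_kernel ev w)))"

end

theory Submission
  imports Defs "HOL-Computational_Algebra.Fundamental_Theorem_Algebra"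
begin

text \<open>
  The inequality is a pointwise one, proved for each unit vector \<open>k\<close> and then applied to the
  normalized kernels. The power mean inequality (\<open>powr_sum_le\<close>) reduces the sum of
  \<open>n\<close> terms to single terms at the cost of the factor \<open>n powr (r - 1)\<close>. For one term,
  \<open>\<bar>\<langle>A\<^sup>* X B k, k\<rangle>\<bar> = \<bar>\<langle>X B k, A k\<rangle>\<bar>\<close> is at most \<open>u * v\<close> with
  \<open>u = norm (f(\<bar>X\<bar>) B k)\<close> and \<open>v = norm (g(\<bar>X\<^sup>*\<bar>) A k)\<close> (\<open>mixed_schwarz\<close>). Here
  \<open>u\<^sup>2 = \<langle>B\<^sup>* f\<^sup>2(\<bar>X\<bar>) B k, k\<rangle>\<close>, and similarly for \<open>v\<close>. Young's inequality with weights
  \<open>\<nu>\<close> and \<open>1 - \<nu>\<close> splits \<open>(u * v) powr r\<close> into a sum, and McCarthy's inequality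
  \<open>\<langle>T k, k\<rangle> powr s \<le> \<langle>(T powr s) k, k\<rangle>\<close> for \<open>s \<ge> 1\<close> (\<open>mccarthy\<close>) moves the exponents into
  the operators; the hypothesis on \<open>r\<close> says that both exponents are at least one. The resulting
  sum \<open>a + b\<close> of real numbers is at most \<open>sqrt 2\<close> times the modulus of \<open>a + \<i> b\<close>, which is the
  value of the right-hand operator at \<open>k\<close>.

  Everything rests on the continuous functional calculus of a positive operator \<open>T\<close> with real
  spectrum \<open>\<sigma>\<close>, whose core is the bound of \<open>norm (p(T))\<close> by the supremum of \<open>\<bar>p\<bar>\<close> on \<open>\<sigma>\<close> for real
  polynomials \<open>p\<close> (\<open>norm_poly_op_le\<close>): a polynomial without root in \<open>\<sigma>\<close> gives an operator that
  is bounded below, as one sees from its factorization (\<open>poly_op_bounded_below\<close>), and this is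
  applied to \<open>N\<^sup>2 - p\<^sup>2\<close>, where \<open>N\<close> is the norm of \<open>p(T)\<close>. The inclusion of \<open>\<sigma>\<close> in a compact interval of the half-line comes from inverting
  coercive operators by the contraction principle. The Weierstrass theorem then extends the
  calculus to continuous functions.

  In the mixed Schwarz inequality the contractions \<open>X (\<bar>X\<bar> + \<epsilon>)\<^sup>-\<^sup>1\<close>, with \<open>\<epsilon>\<close> tending to
  zero, stand for the partial isometry of the polar decomposition of \<open>X\<close>.
\<close>

section \<open>Complex inner products and adjoints\<close>

lemma cinner_zero_left [simp]: "cinner 0 (y::'a::complex_inner) = 0"
  using cinner_add_left[of 0 0 y] by simp

lemma cinner_scaleC_right: "cinner (x::'a::complex_inner) (c *\<^sub>C y) = cnj c * cinner x y"
  by (metis cinner_commute cinner_scaleC_left complex_cnj_mult)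

lemma cinner_scaleR_left: "cinner (r *\<^sub>R (x::'a::complex_inner)) y = of_real r * cinner x y"
  by (simp add: scaleR_scaleC cinner_scaleC_left)

lemma cinner_sum_left: "cinner (\<Sum>i\<in>I. f i) (y::'a::complex_inner) = (\<Sum>i\<in>I. cinner (f i) y)"
  by (induction I rule: infinite_finite_induct) (auto simp: cinner_add_left)

lemma cinner_eq_inner:
  "cinner (x::'a::complex_inner) y = Complex (inner x y) (inner x (\<i> *\<^sub>C y))"
  by (simp add: complex_eq_iff inner_eq_Re_cinner cinner_scaleC_right)

lemma norm_scaleC: "norm (c *\<^sub>C (x::'a::complex_inner)) = cmod c * norm x"
proof -
  have "(norm (c *\<^sub>C x))\<^sup>2 = Re (c * cnj c * cinner x x)"
    by (simp add: power2_norm_eq_inner inner_eq_Re_cinner cinner_scaleC_left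
        cinner_scaleC_right mult_ac)
  also have "c * cnj c = of_real ((cmod c)\<^sup>2)"
    by (rule complex_norm_square[symmetric])
  also have "Re (of_real ((cmod c)\<^sup>2) * cinner x x) = (cmod c * norm x)\<^sup>2"
    by (simp add: power_mult_distrib power2_norm_eq_inner inner_eq_Re_cinner)
  finally show ?thesis
    by simp
qed

text \<open>Rotating \<open>x\<close> by a phase makes \<open>cinner x y\<close> real and nonnegative, which reduces the complex
  Cauchy-Schwarz inequality to the real one.\<close>

lemma cmod_cinner_le: "cmod (cinner (x::'a::complex_inner) y) \<le> norm x * norm y"
proof -
  define c where "c = cnj (sgn (cinner x y))"
  have "c * cinner x y = of_real ((cmod (cinner x y))\<^sup>2) / of_real (cmod (cinner x y))"
    unfolding complex_norm_square by (simp add: c_def sgn_eq mult.commute)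
  also have "\<dots> = of_real (cmod (cinner x y))"
    by (simp add: power2_eq_square)
  finally have "cmod (cinner x y) = Re (cinner (c *\<^sub>C x) y)"
    by (simp add: cinner_scaleC_left)
  also have "\<dots> \<le> norm (c *\<^sub>C x) * norm y"
    unfolding inner_eq_Re_cinner[symmetric] by (rule norm_cauchy_schwarz)
  also have "\<dots> \<le> norm x * norm y"
    by (simp add: c_def norm_scaleC norm_sgn)
  finally show ?thesis .
qed

lemma bounded_clinearD:
  assumes "bounded_clinear T"
  shows "bounded_linear T" "linear T" "T (c *\<^sub>C x) = c *\<^sub>C T x"
  using assms by (auto simp: bounded_clinear_def bounded_linear.linear)

lemma bounded_clinear_compose:
  "bounded_clinear S \<Longrightarrow> bounded_clinear T \<Longrightarrow> bounded_clinear (\<lambda>x. S (T x))"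
  by (simp add: bounded_clinear_def bounded_linear_compose)

lemma bounded_clinear_scaleR: "bounded_clinear (\<lambda>x::'a::complex_inner. r *\<^sub>R x)"
  unfolding bounded_clinear_def
  by (intro conjI bounded_linear_scaleR_right) (simp add: scaleR_scaleC scaleC_scaleC mult.commute)

lemma bounded_clinear_id: "bounded_clinear (\<lambda>x::'a::complex_inner. x)"
  by (simp add: bounded_clinear_def bounded_linear_ident)

lemma bounded_clinear_zero: "bounded_clinear (\<lambda>x::'a::complex_inner. 0::'a)"
  using bounded_clinear_scaleR[of 0] by simp

lemma bounded_clinear_add:
  "bounded_clinear S \<Longrightarrow> bounded_clinear T \<Longrightarrow> bounded_clinear (\<lambda>x. S x + T x)"
  by (simp add: bounded_clinear_def bounded_linear_add scaleC_add_right)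

lemma bounded_clinear_scaleC: "bounded_clinear (\<lambda>x::'a::complex_inner. c *\<^sub>C x)"
  unfolding bounded_clinear_def
  by (intro conjI allI bounded_linear_intro[where K = "cmod c"])
    (simp_all add: scaleC_add_right scaleR_scaleC scaleC_scaleC norm_scaleC mult_ac)

lemma bounded_clinear_diff:
  assumes "bounded_clinear S" "bounded_clinear T"
  shows "bounded_clinear (\<lambda>x. S x - T x)"
  using bounded_clinear_add[OF assms(1)
      bounded_clinear_compose[OF bounded_clinear_scaleR[of "-1"] assms(2)]]
  by simp

lemma bounded_clinear_sum:
  "(\<And>i. i \<in> I \<Longrightarrow> bounded_clinear (f i :: 'a::complex_inner \<Rightarrow> 'a)) \<Longrightarrow> bounded_clinear (\<lambda>x. \<Sum>i\<in>I. f i x)"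
  by (induction I rule: infinite_finite_induct)
    (auto intro: bounded_clinear_add bounded_clinear_zero)

text \<open>The vector representing \<open>\<phi>\<close> is the minimizer of \<open>\<lambda>x. norm x ^ 2 - 2 * \<phi> x\<close>. By the
  parallelogram law every minimizing sequence is Cauchy, so a minimizer exists; the representation
  is then the vanishing of the first variation.\<close>

lemma riesz_representation:
  fixes \<phi> :: "'h::chilbert_space \<Rightarrow> real"
  assumes "bounded_linear \<phi>"
  shows "\<exists>z. \<forall>x. \<phi> x = inner x z"
proof -
  interpret bounded_linear \<phi> by fact
  define F where "F x = (norm x)\<^sup>2 - 2 * \<phi> x" for x
  define m where "m = Inf (range F)"
  obtain L where L: "\<And>x. \<bar>\<phi> x\<bar> \<le> norm x * L"
    using bounded by (metis real_norm_def)
  have "- L\<^sup>2 \<le> F x" for x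
  proof -
    have "0 \<le> (norm x - L)\<^sup>2" by simp
    then show ?thesis
      using L[of x] by (simp add: F_def power2_eq_square algebra_simps)
  qed
  then have bdd: "bdd_below (range F)"
    by (auto intro!: bdd_belowI2)
  then have m_le: "m \<le> F x" for x
    unfolding m_def by (rule cINF_lower) simp
  have "\<exists>x. F x < m + 1 / Suc k" for k
    using cInf_lessD[of "range F" "m + 1 / Suc k"] by (auto simp: m_def)
  then obtain u where u: "\<And>k. F (u k) < m + 1 / Suc k"
    by metis
  have dist_u: "(norm (x - y))\<^sup>2 \<le> 2 * F x + 2 * F y - 4 * m" for x y
  proof -
    have "(norm (x - y))\<^sup>2 = 2 * F x + 2 * F y - 4 * F ((1/2) *\<^sub>R (x + y))"
      by (simp add: F_def power2_norm_eq_inner inner_simps add scale inner_commute algebra_simps)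
    then show ?thesis
      using m_le[of "(1/2) *\<^sub>R (x + y)"] by linarith
  qed
  have "Cauchy u"
  proof (rule metric_CauchyI)
    fix e :: real assume e: "0 < e"
    obtain N where N: "1 / Suc N < e\<^sup>2 / 4"
      using e nat_approx_posE[of "e\<^sup>2 / 4"] by auto
    have "dist (u i) (u j) < e" if "i \<ge> N" "j \<ge> N" for i j
    proof -
      have "1 / Suc i \<le> 1 / Suc N" "1 / Suc j \<le> 1 / Suc N"
        using that by (simp_all add: frac_le)
      then have "(norm (u i - u j))\<^sup>2 < e\<^sup>2"
        using dist_u[of "u i" "u j"] u[of i] u[of j] N by linarith
      then show ?thesis
        using e by (simp add: dist_norm power_less_imp_less_base)
    qed
    then show "\<exists>N. \<forall>i\<ge>N. \<forall>j\<ge>N. dist (u i) (u j) < e"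
      by blast
  qed
  then obtain z where z: "u \<longlonglongrightarrow> z"
    using Cauchy_convergent convergent_def by blast
  have "(\<lambda>k. F (u k)) \<longlonglongrightarrow> F z"
    unfolding F_def by (intro tendsto_intros z tendsto)
  moreover have "(\<lambda>k. m + 1 / Suc k) \<longlonglongrightarrow> m + 0"
    by (intro tendsto_intros LIMSEQ_Suc[OF lim_1_over_n])
  ultimately have "F z \<le> m"
    using LIMSEQ_le[of "\<lambda>k. F (u k)" "F z" "\<lambda>k. m + 1 / Suc k" m] u by (auto intro: less_imp_le)
  have "\<phi> x = inner x z" for x
  proof (cases "x = 0")
    case True
    then show ?thesis by (simp add: zero)
  next
    case False
    \<comment> \<open>The step to the minimum of the parabola \<open>s \<mapsto> F (z + s x)\<close>.\<close>
    define d where "d = inner x z - \<phi> x"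
    define s where "s = - d / (norm x)\<^sup>2"
    have n: "(norm x)\<^sup>2 > 0" using False by simp
    have "F z \<le> F (z + s *\<^sub>R x)"
      using \<open>F z \<le> m\<close> m_le order_trans by blast
    also have "F (z + s *\<^sub>R x) = F z + 2 * s * d + s\<^sup>2 * (norm x)\<^sup>2"
      unfolding F_def d_def power2_norm_eq_inner
      by (simp add: inner_simps add scale inner_commute algebra_simps power2_eq_square)
    also have "\<dots> = F z - d\<^sup>2 / (norm x)\<^sup>2"
      using n by (simp add: s_def power2_eq_square field_simps)
    finally have "d\<^sup>2 / (norm x)\<^sup>2 \<le> 0" by simp
    then have "d = 0"
      using n by (simp add: divide_le_0_iff)
    then show ?thesis by (simp add: d_def)
  qed
  then show ?thesis by blast
qed

lemma inner_left_eqI: "(\<And>x. inner x a = inner x b) \<Longrightarrow> a = (b::'a::real_inner)"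
  by (metis inner_eq_zero_iff inner_diff_right right_minus_eq)

text \<open>A complex functional is determined by its real part, since its imaginary part at \<open>x\<close> is minus
  its real part at \<open>\<i> x\<close>; so the representation of real functionals suffices.\<close>

lemma cadjoint_cinner:
  fixes T :: "'h::chilbert_space \<Rightarrow> 'h"
  assumes T: "bounded_clinear T"
  shows "cinner (T x) y = cinner x (cadjoint T y)"
proof -
  have "\<exists>z. \<forall>x. cinner (T x) y = cinner x z" for y
  proof -
    have "bounded_linear (\<lambda>x. inner (T x) y)"
      using bounded_clinearD(1)[OF T] bounded_linear_inner_left bounded_linear_compose by fast
    then obtain z where z: "\<And>x. inner (T x) y = inner x z"
      using riesz_representation by blast
    have "cinner (T x) y = cinner x z" for x
    proof (rule complex_eqI)
      show "Re (cinner (T x) y) = Re (cinner x z)"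
        using z[of x] by (simp add: inner_eq_Re_cinner)
      show "Im (cinner (T x) y) = Im (cinner x z)"
        using z[of "\<i> *\<^sub>C x"]
        by (simp add: inner_eq_Re_cinner bounded_clinearD(3)[OF T] cinner_scaleC_left)
    qed
    then show ?thesis by blast
  qed
  then obtain S where S: "\<And>x y. cinner (T x) y = cinner x (S y)"
    by metis
  have "S' = S" if "\<forall>x y. cinner (T x) y = cinner x (S' y)" for S'
  proof
    fix y
    have "inner x (S' y) = inner x (S y)" for x
      using that S by (simp add: inner_eq_Re_cinner)
    then show "S' y = S y" by (rule inner_left_eqI)
  qed
  then have "cadjoint T = S"
    unfolding cadjoint_def using S by (intro the_equality) auto
  then show ?thesis using S by simp
qed

lemma cadjoint_inner:
  fixes T :: "'h::chilbert_space \<Rightarrow> 'h"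
  assumes "bounded_clinear T"
  shows "inner (T x) y = inner x (cadjoint T y)"
  by (simp add: inner_eq_Re_cinner cadjoint_cinner[OF assms])

lemma bounded_clinear_cadjoint:
  fixes T :: "'h::chilbert_space \<Rightarrow> 'h"
  assumes T: "bounded_clinear T"
  shows "bounded_clinear (cadjoint T)"
proof -
  note adj = cadjoint_inner[OF T, symmetric]
  obtain L where L: "L > 0" "\<And>x. norm (T x) \<le> norm x * L"
    using bounded_linear.pos_bounded[OF bounded_clinearD(1)[OF T]] by blast
  have "norm (cadjoint T y) \<le> norm y * L" for y
  proof (cases "cadjoint T y = 0")
    case False
    have "(norm (cadjoint T y))\<^sup>2 = inner (T (cadjoint T y)) y"
      by (simp add: power2_norm_eq_inner adj)
    also have "\<dots> \<le> norm (T (cadjoint T y)) * norm y"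
      by (rule norm_cauchy_schwarz)
    also have "\<dots> \<le> (norm (cadjoint T y) * L) * norm y"
      using L by (intro mult_right_mono) auto
    finally show ?thesis
      using False by (simp add: power2_eq_square mult.commute mult_left_le_imp_le)
  qed (use L in auto)
  moreover have "cadjoint T (c *\<^sub>C y) = c *\<^sub>C cadjoint T y" for c y
  proof (rule inner_left_eqI)
    show "inner x (cadjoint T (c *\<^sub>C y)) = inner x (c *\<^sub>C cadjoint T y)" for x
      by (simp add: inner_eq_Re_cinner cadjoint_cinner[OF T, symmetric] cinner_scaleC_right)
  qed
  moreover have "cadjoint T (x + y) = cadjoint T x + cadjoint T y" for x y
    by (rule inner_left_eqI) (simp add: adj inner_add_right)
  moreover have "cadjoint T (r *\<^sub>R x) = r *\<^sub>R cadjoint T x" for r x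
    by (rule inner_left_eqI) (simp add: adj)
  ultimately show ?thesis
    unfolding bounded_clinear_def by (intro conjI allI bounded_linear_intro[where K = L]) auto
qed

lemma cadjoint_cadjoint:
  fixes T :: "'h::chilbert_space \<Rightarrow> 'h"
  assumes T: "bounded_clinear T"
  shows "cadjoint (cadjoint T) = T"
proof
  show "cadjoint (cadjoint T) x = T x" for x
    by (rule inner_left_eqI)
      (metis cadjoint_inner[OF T] cadjoint_inner[OF bounded_clinear_cadjoint[OF T]] inner_commute)
qed

section \<open>Positive operators and their real spectrum\<close>

text \<open>Symmetry and positivity are stated with the real inner product: for a complex-linear operator
  this is equivalent to the complex version and keeps the functional calculus below entirely
  real.\<close>

definition positive_op :: "('h::chilbert_space \<Rightarrow> 'h) \<Rightarrow> bool"
  where "positive_op T \<longleftrightarrow> bounded_clinear T \<and> (\<forall>x y. inner (T x) y = inner x (T y)) \<and>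
    (\<forall>x. 0 \<le> inner (T x) x)"

lemma positive_opD:
  assumes "positive_op T"
  shows "bounded_clinear T" "inner (T x) y = inner x (T y)" "0 \<le> inner (T x) x"
  using assms by (auto simp: positive_op_def)

lemma cinner_symmetric:
  assumes S: "bounded_clinear S" and sym: "\<And>x y. inner (S x) y = inner x (S y)"
  shows "cinner (S x) y = cinner x (S y)"
  using sym[of x y] sym[of x "\<i> *\<^sub>C y"] by (simp add: cinner_eq_inner bounded_clinearD(3)[OF S])

lemma cinner_positive_op:
  assumes T: "positive_op T"
  shows "cinner (T x) x = of_real (inner (T x) x)"
proof -
  have "cinner (T x) x = cinner x (T x)"
    by (rule cinner_symmetric[OF positive_opD(1,2)[OF T]])
  also have "\<dots> = cnj (cinner (T x) x)"
    by (rule cinner_commute)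
  finally show ?thesis
    by (simp add: complex_eq_iff inner_eq_Re_cinner)
qed

lemma positive_op_conj:
  assumes P: "positive_op P" and A: "bounded_clinear A"
  shows "positive_op (cadjoint A \<circ> P \<circ> A)"
  unfolding positive_op_def
proof (intro conjI allI)
  note adj = cadjoint_inner[OF A, symmetric]
  have adj': "inner (cadjoint A x) y = inner x (A y)" for x y
    using adj by (metis inner_commute)
  show "bounded_clinear (cadjoint A \<circ> P \<circ> A)"
    unfolding comp_def
    by (rule bounded_clinear_compose[OF bounded_clinear_cadjoint[OF A]
          bounded_clinear_compose[OF positive_opD(1)[OF P] A]])
  show "inner ((cadjoint A \<circ> P \<circ> A) x) y = inner x ((cadjoint A \<circ> P \<circ> A) y)" for x y
    by (simp add: adj adj' positive_opD(2)[OF P])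
  show "0 \<le> inner ((cadjoint A \<circ> P \<circ> A) x) x" for x
    by (simp add: adj' positive_opD(3)[OF P])
qed

definition real_spectrum :: "('h::chilbert_space \<Rightarrow> 'h) \<Rightarrow> real set"
  where "real_spectrum T = {t. complex_of_real t \<in> op_spectrum T}"

text \<open>Solving \<open>T x = y\<close> is finding the fixed point of \<open>x \<mapsto> x - \<rho> (T x - y)\<close>. By coercivity this map
  contracts squared distances by \<open>1 - 2 \<rho> c + \<rho>\<^sup>2 M\<^sup>2\<close>, where \<open>M\<close> bounds \<open>T\<close>, and the
  choice \<open>\<rho> = c / M\<^sup>2\<close> makes this less than one.\<close>

lemma coercive_imp_invertible:
  fixes T :: "'h::chilbert_space \<Rightarrow> 'h"
  assumes T: "bounded_clinear T" and c: "c > 0"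
    and coercive: "\<And>x. c * (norm x)\<^sup>2 \<le> inner (T x) x"
  shows "\<exists>S. bounded_clinear S \<and> (\<forall>x. S (T x) = x) \<and> (\<forall>x. T (S x) = x)"
proof -
  interpret bounded_linear T using T bounded_clinearD by blast
  have below: "c * norm x \<le> norm (T x)" for x
  proof (cases "x = 0")
    case False
    have "(c * norm x) * norm x \<le> norm (T x) * norm x"
      using coercive[of x] norm_cauchy_schwarz[of "T x" x] by (simp add: power2_eq_square mult_ac)
    then show ?thesis using False by simp
  qed (simp add: zero)
  obtain M0 where M0: "\<And>x. norm (T x) \<le> norm x * M0"
    using bounded by blast
  define M where "M = max M0 c"
  have M: "M > 0" "c \<le> M" "norm (T x) \<le> M * norm x" for x
  proof -
    show "norm (T x) \<le> M * norm x"
      using M0[of x] mult_left_mono[of M0 M "norm x"] by (simp add: M_def mult.commute)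
  qed (use c in \<open>auto simp: M_def\<close>)
  define \<rho> where "\<rho> = c / M\<^sup>2"
  define q where "q = sqrt (1 - c\<^sup>2 / M\<^sup>2)"
  have cM: "c\<^sup>2 / M\<^sup>2 \<le> 1" "0 < c\<^sup>2 / M\<^sup>2"
    using M c by (simp_all add: power_mono)
  have q: "0 \<le> q" "q < 1" "q\<^sup>2 = 1 - c\<^sup>2 / M\<^sup>2"
    using cM by (auto simp: q_def)
  have ex1: "\<exists>!x. T x = y" for y
  proof -
    define G where "G x = x - \<rho> *\<^sub>R (T x - y)" for x
    have "dist (G x) (G x') \<le> q * dist x x'" for x x'
    proof -
      define d where "d = x - x'"
      have "G x - G x' = d - \<rho> *\<^sub>R T d"
        by (simp add: G_def d_def diff algebra_simps)
      then have "(norm (G x - G x'))\<^sup>2 = (norm (d - \<rho> *\<^sub>R T d))\<^sup>2"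
        by simp
      also have "\<dots> = (norm d)\<^sup>2 - 2 * \<rho> * inner (T d) d + \<rho>\<^sup>2 * (norm (T d))\<^sup>2"
        unfolding power2_norm_eq_inner
        by (simp add: inner_simps inner_commute algebra_simps power2_eq_square)
      also have "\<dots> \<le> (norm d)\<^sup>2 - 2 * \<rho> * (c * (norm d)\<^sup>2) + \<rho>\<^sup>2 * (M * norm d)\<^sup>2"
        using c M coercive[of d] by (intro add_mono diff_mono mult_left_mono power_mono)
          (auto simp: \<rho>_def)
      also have "\<dots> = q\<^sup>2 * (norm d)\<^sup>2"
        using M unfolding q(3) by (simp add: \<rho>_def field_simps power2_eq_square)
      also have "\<dots> = (q * norm d)\<^sup>2" by (simp add: power_mult_distrib)
      finally show ?thesis
        using q by (auto simp: dist_norm d_def intro: power2_le_imp_le)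
    qed
    then have "\<exists>!x. G x = x"
      using banach_fix_type[OF q(1,2)] by blast
    moreover have "G x = x \<longleftrightarrow> T x = y" for x
      using c M by (auto simp: G_def \<rho>_def)
    ultimately show ?thesis by simp
  qed
  define S where "S y = (THE x. T x = y)" for y
  have TS: "T (S y) = y" for y
    unfolding S_def by (rule theI'[OF ex1])
  have ST: "S (T x) = x" for x
    unfolding S_def using ex1[of "T x"] by (intro the1_equality) auto
  have "norm (S y) \<le> norm y * (1 / c)" for y
    using below[of "S y"] c by (simp add: TS field_simps)
  moreover have "S (x + y) = S x + S y" for x y
    by (metis ST TS add)
  moreover have "S (r *\<^sub>R x) = r *\<^sub>R S x" for r x
    by (metis ST TS scale)
  moreover have "S (r *\<^sub>C x) = r *\<^sub>C S x" for r x
    by (metis ST TS bounded_clinearD(3)[OF T])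
  ultimately have "bounded_clinear S"
    unfolding bounded_clinear_def by (intro conjI bounded_linear_intro[where K = "1 / c"]) auto
  then show ?thesis using ST TS by blast
qed

text \<open>The sign \<open>s\<close> covers both sides of the spectrum of a positive operator: \<open>T - t\<close> is coercive
  for \<open>t < 0\<close>, and \<open>t - T\<close> is coercive for \<open>t > norm T\<close>.\<close>

lemma coercive_shift_not_in_real_spectrum:
  fixes T :: "'h::chilbert_space \<Rightarrow> 'h"
  assumes T: "bounded_clinear T" and c: "c > 0" and s: "\<bar>s\<bar> = 1"
    and coercive: "\<And>x. c * (norm x)\<^sup>2 \<le> s * inner (T x - t *\<^sub>R x) x"
  shows "t \<notin> real_spectrum T"
proof -
  have s2: "s * s = 1" using s by (metis abs_mult_self_eq mult_1)
  have *: "bounded_clinear (\<lambda>x. s *\<^sub>R (T x - t *\<^sub>R x))"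
    by (intro bounded_clinear_compose[OF bounded_clinear_scaleR] bounded_clinear_diff T
        bounded_clinear_scaleR)
  obtain S where S: "bounded_clinear S" "\<And>x. S (s *\<^sub>R (T x - t *\<^sub>R x)) = x"
      "\<And>x. s *\<^sub>R (T (S x) - t *\<^sub>R S x) = x"
    using coercive_imp_invertible[OF * c] coercive by (auto simp: inner_simps)
  define S' where "S' x = S (s *\<^sub>R x)" for x
  have "bounded_clinear S'"
    unfolding S'_def by (intro bounded_clinear_compose[OF S(1)] bounded_clinear_scaleR)
  moreover have "S' (T x - t *\<^sub>R x) = x" for x
    by (simp add: S'_def S)
  moreover have "T (S' x) - t *\<^sub>R S' x = x" for x
    using S(3)[of "s *\<^sub>R x"] arg_cong[OF S(3)[of "s *\<^sub>R x"], of "\<lambda>z. s *\<^sub>R z"]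
    by (simp add: S'_def s2)
  ultimately show ?thesis
    by (auto simp: real_spectrum_def op_spectrum_def scaleR_scaleC[symmetric])
qed

lemma real_spectrum_positive_op:
  fixes T :: "'h::chilbert_space \<Rightarrow> 'h"
  assumes T: "positive_op T"
  shows "real_spectrum T \<subseteq> {0..onorm T}"
proof
  fix t assume t: "t \<in> real_spectrum T"
  note T' = positive_opD[OF T]
  have "\<not> t < 0"
  proof
    assume "t < 0"
    then have "t \<notin> real_spectrum T"
      using T' by (intro coercive_shift_not_in_real_spectrum[of T "-t" 1])
        (auto simp: inner_simps power2_norm_eq_inner)
    with t show False by simp
  qed
  moreover have "\<not> t > onorm T"
  proof
    assume gt: "t > onorm T"
    have "inner (T x) x \<le> onorm T * (norm x)\<^sup>2" for x
    proof -
      have "inner (T x) x \<le> norm (T x) * norm x" by (rule norm_cauchy_schwarz)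
      also have "\<dots> \<le> onorm T * norm x * norm x"
        by (intro mult_right_mono onorm bounded_clinearD(1) T') auto
      finally show ?thesis by (simp add: power2_eq_square)
    qed
    then have "t \<notin> real_spectrum T"
      using gt T' by (intro coercive_shift_not_in_real_spectrum[of T "t - onorm T" "-1"])
        (auto simp: inner_simps power2_norm_eq_inner algebra_simps)
    with t show False by simp
  qed
  ultimately show "t \<in> {0..onorm T}" by auto
qed

lemma bounded_below_if_not_in_real_spectrum:
  fixes T :: "'h::chilbert_space \<Rightarrow> 'h"
  assumes "t \<notin> real_spectrum T"
  shows "\<exists>c>0. \<forall>x. c * norm x \<le> norm (T x - t *\<^sub>R x)"
proof -
  obtain S where S: "bounded_clinear S" "\<And>x. S (T x - t *\<^sub>R x) = x"
    using assms by (auto simp: real_spectrum_def op_spectrum_def scaleR_scaleC[symmetric])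
  obtain L where L: "L > 0" "\<And>x. norm (S x) \<le> norm x * L"
    using bounded_linear.pos_bounded[OF bounded_clinearD(1)[OF S(1)]] by blast
  have "1 / L * norm x \<le> norm (T x - t *\<^sub>R x)" for x
    using L(2)[of "T x - t *\<^sub>R x"] L(1) by (simp add: S(2) field_simps)
  then show ?thesis using L(1) by (intro exI[of _ "1 / L"]) auto
qed

section \<open>Polynomials of an operator\<close>

lemma poly_op_0 [simp]: "poly_op 0 T x = 0"
  by (simp add: poly_op_def)

lemma poly_op_pCons:
  assumes "linear T"
  shows "poly_op (pCons a p) T x = a *\<^sub>R x + T (poly_op p T x)"
proof (cases "p = 0")
  case True
  then show ?thesis using linear_0[OF assms] by (simp add: poly_op_def)
next
  case False
  then show ?thesis
    by (simp add: poly_op_def sum.atMost_Suc_shift linear_sum[OF assms] linear_scale[OF assms]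
        del: sum.atMost_Suc)
qed

context
  fixes T :: "'h::chilbert_space \<Rightarrow> 'h"
  assumes T: "linear T"
begin

lemma poly_op_add: "poly_op (p + q) T x = poly_op p T x + poly_op q T x"
  by (induction p q rule: poly_induct2) (simp_all add: poly_op_pCons T linear_add scaleR_add_left)

lemma poly_op_smult: "poly_op (smult c p) T x = c *\<^sub>R poly_op p T x"
  by (induction p) (simp_all add: poly_op_pCons T linear_scale scaleR_add_right)

lemma poly_op_diff: "poly_op (p - q) T x = poly_op p T x - poly_op q T x"
  using poly_op_add[of p "smult (-1) q" x] poly_op_smult[of "-1" q x] by simp

lemma poly_op_mult: "poly_op (p * q) T x = poly_op p T (poly_op q T x)"
  by (induction p) (simp_all add: poly_op_pCons T poly_op_add poly_op_smult)

end

lemma bounded_clinear_poly_op: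
  fixes T :: "'h::chilbert_space \<Rightarrow> 'h"
  assumes T: "bounded_clinear T"
  shows "bounded_clinear (poly_op p T)"
proof (induction p)
  case 0
  have "poly_op 0 T = (\<lambda>x. 0)" by (simp add: fun_eq_iff)
  then show ?case using bounded_clinear_zero by simp
next
  case (pCons a p)
  have "poly_op (pCons a p) T = (\<lambda>x. a *\<^sub>R x + T (poly_op p T x))"
    using bounded_clinearD(2)[OF T] by (simp add: fun_eq_iff poly_op_pCons)
  then show ?case
    using bounded_clinear_add[OF bounded_clinear_scaleR bounded_clinear_compose[OF T pCons.IH]]
    by simp
qed

lemma poly_op_intertwine:
  assumes "linear T" "linear T'" "linear X" "\<And>x. X (T x) = T' (X x)"
  shows "X (poly_op p T x) = poly_op p T' (X x)"
  using assms(4) by (induction p)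
    (simp_all add: poly_op_pCons assms(1-3) linear_add linear_scale linear_0)

lemma poly_op_symmetric:
  fixes T :: "'h::chilbert_space \<Rightarrow> 'h"
  assumes T: "linear T" and sym: "\<And>x y. inner (T x) y = inner x (T y)"
  shows "inner (poly_op p T x) y = inner x (poly_op p T y)"
proof (induction p arbitrary: x y)
  case (pCons a p)
  have "T (poly_op p T y) = poly_op p T (T y)"
    using poly_op_intertwine[of T T T] T by blast
  then show ?case
    using pCons.IH by (simp add: poly_op_pCons T inner_simps sym)
qed simp

text \<open>A real polynomial splits over the reals into linear factors \<open>t - a\<close> and quadratic factors
  \<open>(t - a)\<^sup>2 + b\<^sup>2\<close> with \<open>b \<noteq> 0\<close>. A linear factor without root in the spectrum gives an operator
  with bounded inverse, and a quadratic factor gives an operator bounded below by \<open>b\<^sup>2\<close>, whatever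
  the symmetric operator; a composition of operators bounded below is bounded below.\<close>

lemma poly_op_bounded_below:
  fixes T :: "'h::chilbert_space \<Rightarrow> 'h"
  assumes T: "bounded_clinear T" and sym: "\<And>x y. inner (T x) y = inner x (T y)"
    and "q \<noteq> 0" and "\<And>t. t \<in> real_spectrum T \<Longrightarrow> poly q t \<noteq> 0"
  shows "\<exists>c>0. \<forall>x. c * norm x \<le> norm (poly_op q T x)"
  using assms(3,4)
proof (induction "degree q" arbitrary: q rule: less_induct)
  case less
  note lin = bounded_clinearD(2)[OF T]
  have factor: ?case
    if q: "q = m * q'" and deg: "degree m > 0"
      and m: "\<exists>c>0. \<forall>x. c * norm x \<le> norm (poly_op m T x)" for m q'
  proof -
    have nz: "m \<noteq> 0" "q' \<noteq> 0" using less.prems(1) q by auto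
    then have "degree q' < degree q"
      using deg by (simp add: q degree_mult_eq)
    then obtain c' where c': "c' > 0" "\<And>x. c' * norm x \<le> norm (poly_op q' T x)"
      using less.hyps[of q'] nz less.prems(2) by (auto simp: q)
    obtain c where c: "c > 0" "\<And>x. c * norm x \<le> norm (poly_op m T x)"
      using m by blast
    have "c * c' * norm x \<le> norm (poly_op q T x)" for x
    proof -
      have "c * c' * norm x \<le> c * norm (poly_op q' T x)"
        using c c' by simp
      also have "\<dots> \<le> norm (poly_op q T x)"
        using c by (simp add: q poly_op_mult lin)
      finally show ?thesis .
    qed
    then show ?thesis
      using c c' by (intro exI[of _ "c * c'"]) auto
  qed
  show ?case
  proof (cases "degree q = 0")
    case True
    then obtain a where a: "q = [:a:]" by (rule degree_eq_zeroE)
    with less.prems(1) show ?thesis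
      by (intro exI[of _ "\<bar>a\<bar>"]) (auto simp: poly_op_pCons lin linear_0)
  next
    case False
    define P where "P = map_poly complex_of_real q"
    have map_poly_real: "poly (map_poly complex_of_real p) (of_real t) = of_real (poly p t)" for p t
      by (induction p) (auto simp: map_poly_pCons)
    have "degree P = degree q"
      unfolding P_def by (intro degree_map_poly) auto
    then obtain z where z: "poly P z = 0"
      using fundamental_theorem_of_algebra[of P] False by (auto simp: constant_degree)
    define a b where "a = Re z" and "b = Im z"
    show ?thesis
    proof (cases "b = 0")
      case True
      then have "z = of_real a" by (simp add: a_def b_def complex_eq_iff)
      then have root: "poly q a = 0"
        using z by (simp add: P_def map_poly_real)
      then obtain q' where q': "q = [:-a, 1:] * q'"
        by (auto simp: poly_eq_0_iff_dvd dvd_def)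
      have op: "poly_op [:-a, 1:] T x = T x - a *\<^sub>R x" for x
        by (simp add: poly_op_pCons lin linear_0)
      have "a \<notin> real_spectrum T" using less.prems(2) root by blast
      then show ?thesis
        using factor[OF q'] bounded_below_if_not_in_real_spectrum[of a T] by (simp add: op)
    next
      case False
      define m where "m = [:a\<^sup>2 + b\<^sup>2, -2 * a, 1:]"
      define s where "s = q mod m"
      have deg_m: "degree m = 2" by (simp add: m_def)
      have "degree s < 2"
        using degree_mod_less[of m q] deg_m by (auto simp: s_def m_def)
      define s0 s1 where "s0 = coeff s 0" and "s1 = coeff s 1"
      have s: "s = [:s0, s1:]"
        using \<open>degree s < 2\<close>
        by (intro poly_eqI) (auto simp: s0_def s1_def coeff_pCons coeff_eq_0 split: nat.splits)
      have q: "q = m * (q div m) + s" by (simp add: s_def)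
      have hom: "map_poly complex_of_real (x + y) = map_poly of_real x + map_poly of_real y"
        "map_poly complex_of_real (x * y) = map_poly of_real x * map_poly of_real y" for x y
        by (auto simp: poly_eq_iff coeff_map_poly coeff_mult)
      have "poly (map_poly of_real m) z = 0"
        by (simp add: m_def map_poly_pCons complex_eq_iff a_def b_def power2_eq_square algebra_simps)
      then have "poly (map_poly of_real s) z = 0"
        using z unfolding P_def by (subst (asm) (1) q) (simp add: hom)
      then have "s0 + s1 * a = 0" "s1 * b = 0"
        by (auto simp: s map_poly_pCons complex_eq_iff a_def b_def mult.commute)
      then have "s = 0" using False s by auto
      then have q': "q = m * (q div m)" using q by simp
      have "b\<^sup>2 * norm x \<le> norm (poly_op m T x)" for x
      proof (cases "x = 0")
        case False
        have two: "(a * 2) *\<^sub>R y = a *\<^sub>R y + a *\<^sub>R y" for y :: 'h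
          unfolding mult_2_right by (rule scaleR_add_left)
        have op: "poly_op m T x = T (T x - a *\<^sub>R x) - a *\<^sub>R (T x - a *\<^sub>R x) + b\<^sup>2 *\<^sub>R x"
          by (simp add: m_def poly_op_pCons lin linear_0 linear_add linear_diff linear_scale
              algebra_simps power2_eq_square) (simp add: two)
        have "inner (T (T x - a *\<^sub>R x) - a *\<^sub>R (T x - a *\<^sub>R x) + b\<^sup>2 *\<^sub>R x) x
            = (norm (T x - a *\<^sub>R x))\<^sup>2 + b\<^sup>2 * (norm x)\<^sup>2"
          by (simp add: power2_norm_eq_inner inner_simps sym inner_commute algebra_simps
              linear_diff[OF lin] linear_scale[OF lin])
        then have "b\<^sup>2 * (norm x)\<^sup>2 \<le> inner (poly_op m T x) x"
          by (simp add: op)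
        also have "\<dots> \<le> norm (poly_op m T x) * norm x"
          by (rule norm_cauchy_schwarz)
        finally have "(b\<^sup>2 * norm x) * norm x \<le> norm (poly_op m T x) * norm x"
          by (simp add: power2_eq_square mult_ac)
        then show ?thesis using False by simp
      qed simp
      then show ?thesis
        using factor[OF q'] deg_m False by (metis zero_less_power2 pos2)
    qed
  qed
qed

text \<open>If \<open>N\<^sup>2 - p\<^sup>2\<close> had no root in the spectrum, \<open>N\<^sup>2 - p(T)\<^sup>2\<close> would be bounded below. This
  forces \<open>norm (p(T) x)\<close> to stay away from \<open>N * norm x\<close>, which is impossible if \<open>N\<close> is the norm
  of \<open>p(T)\<close>. If \<open>p\<^sup>2\<close> is the constant \<open>N\<^sup>2\<close>, every point of the spectrum will
  do, and the argument for the polynomial \<open>t\<close> shows that there is one.\<close>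

lemma poly_op_attains_norm:
  fixes T :: "'h::chilbert_space \<Rightarrow> 'h"
  assumes T: "bounded_clinear T" and sym: "\<And>x y. inner (T x) y = inner x (T y)"
    and x0: "(x0::'h) \<noteq> 0"
  shows "\<exists>t\<in>real_spectrum T. \<bar>poly p t\<bar> = onorm (poly_op p T)"
proof -
  note lin = bounded_clinearD(2)[OF T]
  have root: "\<exists>t\<in>real_spectrum T. \<bar>poly p t\<bar> = onorm (poly_op p T)"
    if nz: "[:(onorm (poly_op p T))\<^sup>2:] - p * p \<noteq> 0" for p
  proof -
    define S where "S = poly_op p T"
    define N where "N = onorm S"
    define q where "q = [:N\<^sup>2:] - p * p"
    have S: "bounded_linear S"
      unfolding S_def by (intro bounded_clinearD(1) bounded_clinear_poly_op T)
    have N0: "0 \<le> N" unfolding N_def by (rule onorm_pos_le[OF S])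
    have S_le: "norm (S x) \<le> N * norm x" for x
      unfolding N_def by (rule onorm[OF S])
    have op_q: "poly_op q T x = N\<^sup>2 *\<^sub>R x - S (S x)" for x
      by (simp add: q_def S_def poly_op_diff poly_op_mult poly_op_pCons lin linear_0)
    have "\<exists>t\<in>real_spectrum T. poly q t = 0"
    proof (rule ccontr)
      assume "\<not> ?thesis"
      then obtain c where c: "c > 0" "\<And>x. c * norm x \<le> norm (N\<^sup>2 *\<^sub>R x - S (S x))"
        using poly_op_bounded_below[OF T sym, of q] nz unfolding op_q
        by (auto simp: q_def N_def S_def)
      have gap: "c\<^sup>2 * (norm x)\<^sup>2 \<le> N\<^sup>2 * (N\<^sup>2 * (norm x)\<^sup>2 - (norm (S x))\<^sup>2)" for x
      proof -
        have "inner x (S (S x)) = (norm (S x))\<^sup>2"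
          unfolding S_def power2_norm_eq_inner by (simp add: poly_op_symmetric[OF lin sym])
        then have "(norm (N\<^sup>2 *\<^sub>R x - S (S x)))\<^sup>2
            = N\<^sup>2 * N\<^sup>2 * (norm x)\<^sup>2 - 2 * N\<^sup>2 * (norm (S x))\<^sup>2 + (norm (S (S x)))\<^sup>2"
          unfolding power2_norm_eq_inner
          by (simp add: inner_simps inner_commute algebra_simps power2_eq_square)
        moreover have "(norm (S (S x)))\<^sup>2 \<le> N\<^sup>2 * (norm (S x))\<^sup>2"
          using power_mono[OF S_le[of "S x"], of 2] by (simp add: power_mult_distrib)
        moreover have "(c * norm x)\<^sup>2 \<le> (norm (N\<^sup>2 *\<^sub>R x - S (S x)))\<^sup>2"
          using c by (intro power_mono) auto
        ultimately show ?thesis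
          by (simp add: power_mult_distrib algebra_simps)
      qed
      have "N \<noteq> 0"
        using gap[of x0] c x0 by (auto simp: zero_less_mult_iff mult_le_0_iff)
      then have N: "N > 0" using N0 by simp
      define d where "d = N\<^sup>2 - c\<^sup>2 / N\<^sup>2"
      have d: "(norm (S x))\<^sup>2 \<le> d * (norm x)\<^sup>2" for x
        using gap[of x] N by (simp add: d_def field_simps)
      have "0 \<le> d * (norm x0)\<^sup>2" using d[of x0] by (meson order_trans zero_le_power2)
      then have "0 \<le> d" using x0 by (simp add: zero_le_mult_iff)
      have "norm (S x) \<le> sqrt d * norm x" for x
        using real_sqrt_le_mono[OF d[of x]] by (simp add: real_sqrt_mult)
      then have "N \<le> sqrt d"
        unfolding N_def using \<open>0 \<le> d\<close> by (intro onorm_bound) auto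
      then have "N\<^sup>2 \<le> d"
        using N \<open>0 \<le> d\<close> by (metis N0 power_mono real_sqrt_pow2)
      then show False using c N by (simp add: d_def divide_le_0_iff)
    qed
    then obtain t where "t \<in> real_spectrum T" "\<bar>poly p t\<bar>\<^sup>2 = N\<^sup>2"
      by (auto simp: q_def power2_eq_square)
    then show ?thesis
      using N0 by (intro bexI[of _ t]) (auto simp: N_def S_def power2_eq_iff)
  qed
  show ?thesis
  proof (cases "[:(onorm (poly_op p T))\<^sup>2:] - p * p = 0")
    case True
    have "[:(onorm (poly_op [:0, 1:] T))\<^sup>2:] - [:0, 1:] * [:0, 1:] \<noteq> (0 :: real poly)"
      by simp
    then obtain t where t: "t \<in> real_spectrum T"
      using root by blast
    have "poly ([:(onorm (poly_op p T))\<^sup>2:] - p * p) t = 0"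
      using True by simp
    then have "\<bar>poly p t\<bar>\<^sup>2 = (onorm (poly_op p T))\<^sup>2"
      by (simp add: power2_eq_square)
    moreover have "0 \<le> onorm (poly_op p T)"
      by (intro onorm_pos_le bounded_clinearD(1) bounded_clinear_poly_op T)
    ultimately show ?thesis
      using t by (intro bexI[of _ t]) (auto simp: power2_eq_iff)
  qed (rule root)
qed

lemma norm_poly_op_le:
  fixes T :: "'h::chilbert_space \<Rightarrow> 'h"
  assumes T: "bounded_clinear T" and sym: "\<And>x y. inner (T x) y = inner x (T y)"
    and bound: "\<And>t. t \<in> real_spectrum T \<Longrightarrow> \<bar>poly p t\<bar> \<le> M"
  shows "norm (poly_op p T x) \<le> M * norm x"
proof (cases "x = 0")
  case True
  then show ?thesis
    using linear_0[OF bounded_clinearD(2)[OF bounded_clinear_poly_op[OF T]]] by simp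
next
  case False
  then obtain t where "t \<in> real_spectrum T" "\<bar>poly p t\<bar> = onorm (poly_op p T)"
    using poly_op_attains_norm[OF T sym] by blast
  then have "onorm (poly_op p T) \<le> M" using bound by metis
  moreover have "norm (poly_op p T x) \<le> onorm (poly_op p T) * norm x"
    by (intro onorm bounded_clinearD(1) bounded_clinear_poly_op T)
  ultimately show ?thesis
    by (meson mult_right_mono norm_ge_zero order_trans)
qed

section \<open>The continuous functional calculus of a positive operator\<close>

text \<open>Pointwise convergence of the operators is enough in this definition: the norm bound for
  polynomials turns uniform convergence on the spectrum into convergence in operator norm.\<close>

definition is_cfc :: "(real \<Rightarrow> real) \<Rightarrow> ('h::chilbert_space \<Rightarrow> 'h) \<Rightarrow> ('h \<Rightarrow> 'h) \<Rightarrow> bool"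
  where "is_cfc f T S \<longleftrightarrow> bounded_clinear S \<and> (\<exists>p.
    uniform_limit (real_spectrum T) (\<lambda>m. poly (p m)) f sequentially \<and>
    (\<forall>x. (\<lambda>m. poly_op (p m) T x) \<longlonglongrightarrow> S x))"

lemma norm_poly_op_diff_le:
  fixes T :: "'h::chilbert_space \<Rightarrow> 'h"
  assumes "positive_op T" and "\<And>t. t \<in> real_spectrum T \<Longrightarrow> \<bar>poly p t - poly q t\<bar> \<le> e"
  shows "norm (poly_op p T x - poly_op q T x) \<le> e * norm x"
  using norm_poly_op_le[of T "p - q" e x] positive_opD[OF assms(1)] assms(2)
  by (simp add: poly_op_diff bounded_clinearD(2))

lemma weierstrass_poly:
  fixes f :: "real \<Rightarrow> real"
  assumes "continuous_on {a..b} f"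
  shows "\<exists>p. uniform_limit {a..b} (\<lambda>m. poly (p m)) f sequentially"
proof -
  have "\<exists>p. \<forall>t\<in>{a..b}. \<bar>poly p t - f t\<bar> < 1 / Suc m" for m
  proof -
    obtain g where g: "real_polynomial_function g" "\<And>t. t \<in> {a..b} \<Longrightarrow> \<bar>f t - g t\<bar> < 1 / Suc m"
      using Stone_Weierstrass_real_polynomial_function[OF compact_Icc assms, of "1 / Suc m"] by auto
    then obtain c n where "g = (\<lambda>x. \<Sum>i\<le>n. c i * x ^ i)"
      unfolding real_polynomial_function_iff_sum by blast
    then have "g = poly (\<Sum>i\<le>n. monom (c i) i)"
      by (simp add: fun_eq_iff poly_sum poly_monom)
    then show ?thesis
      using g(2) by (intro exI[of _ "\<Sum>i\<le>n. monom (c i) i"]) (auto simp: abs_minus_commute)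
  qed
  then obtain p where p: "\<And>m t. t \<in> {a..b} \<Longrightarrow> \<bar>poly (p m) t - f t\<bar> < 1 / Suc m"
    by metis
  have "uniform_limit {a..b} (\<lambda>m. poly (p m)) f sequentially"
  proof (rule uniform_limitI)
    fix e :: real assume "e > 0"
    then have "\<forall>\<^sub>F m in sequentially. 1 / Suc m < e"
      using LIMSEQ_Suc[OF lim_1_over_n, where 'a1 = real] by (intro order_tendstoD(2)) auto
    then show "\<forall>\<^sub>F m in sequentially. \<forall>t\<in>{a..b}. dist (poly (p m) t) (f t) < e"
    proof eventually_elim
      case (elim m)
      then show ?case
        using p[of _ m] by (fastforce simp: dist_real_def)
    qed
  qed
  then show ?thesis by blast
qed

lemma is_cfc_approx:
  fixes T :: "'h::chilbert_space \<Rightarrow> 'h"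
  assumes T: "positive_op T" and S: "is_cfc f T S"
    and e: "\<And>t. t \<in> real_spectrum T \<Longrightarrow> \<bar>poly q t - f t\<bar> \<le> e"
  shows "norm (poly_op q T x - S x) \<le> e * norm x"
proof (rule field_le_epsilon)
  fix d :: real assume d: "d > 0"
  define d' where "d' = d / (norm x + 1)"
  have nx: "norm x + 1 > 0" using norm_ge_zero[of x] by linarith
  have d': "d' > 0" "d' * norm x \<le> d"
    using d nx by (auto simp: d'_def field_simps)
  obtain p where p: "uniform_limit (real_spectrum T) (\<lambda>m. poly (p m)) f sequentially"
    "(\<lambda>m. poly_op (p m) T x) \<longlonglongrightarrow> S x"
    using S unfolding is_cfc_def by blast
  have "\<forall>\<^sub>F m in sequentially. norm (poly_op q T x - poly_op (p m) T x) \<le> (e + d') * norm x"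
    using uniform_limitD[OF p(1) d'(1)]
  proof eventually_elim
    case (elim m)
    show ?case
    proof (rule norm_poly_op_diff_le[OF T])
      fix t assume "t \<in> real_spectrum T"
      then show "\<bar>poly q t - poly (p m) t\<bar> \<le> e + d'"
        using e[of t] elim by (fastforce simp: dist_real_def)
    qed
  qed
  moreover have "(\<lambda>m. norm (poly_op q T x - poly_op (p m) T x)) \<longlonglongrightarrow> norm (poly_op q T x - S x)"
    by (intro tendsto_intros p)
  ultimately have "norm (poly_op q T x - S x) \<le> (e + d') * norm x"
    by (intro tendsto_upperbound) auto
  then show "norm (poly_op q T x - S x) \<le> e * norm x + d"
    using d'(2) by (simp add: distrib_right)
qed

text \<open>An approximating sequence converges in operator norm by the norm bound, and it is the existence
  of such a sequence, part of \<open>is_cfc\<close>, that makes the operator in the definition of \<open>cfc\<close>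
  unique.\<close>

lemma cfc_eqI:
  fixes T :: "'h::chilbert_space \<Rightarrow> 'h"
  assumes T: "positive_op T" and S: "is_cfc f T S"
  shows "cfc f T = S"
  unfolding cfc_def real_spectrum_def[symmetric]
proof (rule the_equality)
  have bS: "bounded_clinear S" using S by (simp add: is_cfc_def)
  have pS: "bounded_linear (\<lambda>x. poly_op q T x - R x)" if "bounded_clinear R" for q and R :: "'h \<Rightarrow> 'h"
    by (intro bounded_linear_sub bounded_clinearD(1) bounded_clinear_poly_op that positive_opD[OF T])
  have lim: "(\<lambda>m. onorm (\<lambda>x. poly_op (q m) T x - S x)) \<longlonglongrightarrow> 0"
    if q: "uniform_limit (real_spectrum T) (\<lambda>m. poly (q m)) f sequentially" for q
  proof (rule tendstoI)
    fix e :: real assume e: "e > 0"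
    show "\<forall>\<^sub>F m in sequentially. dist (onorm (\<lambda>x. poly_op (q m) T x - S x)) 0 < e"
      using uniform_limitD[OF q half_gt_zero[OF e]]
    proof eventually_elim
      case (elim m)
      have "onorm (\<lambda>x. poly_op (q m) T x - S x) \<le> e / 2"
        using e elim by (intro onorm_bound is_cfc_approx[OF T S]) (auto simp: dist_real_def less_imp_le)
      then show ?case
        using onorm_pos_le[OF pS[OF bS]] e by (simp add: dist_real_def)
    qed
  qed
  then show "bounded_clinear S \<and> (\<forall>p. uniform_limit (real_spectrum T) (\<lambda>m. poly (p m)) f sequentially
      \<longrightarrow> (\<lambda>m. onorm (\<lambda>x. poly_op (p m) T x - S x)) \<longlonglongrightarrow> 0)"
    using bS by blast
  fix R :: "'h \<Rightarrow> 'h"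
  assume R: "bounded_clinear R \<and> (\<forall>p. uniform_limit (real_spectrum T) (\<lambda>m. poly (p m)) f sequentially
      \<longrightarrow> (\<lambda>m. onorm (\<lambda>x. poly_op (p m) T x - R x)) \<longlonglongrightarrow> 0)"
  obtain p where p: "uniform_limit (real_spectrum T) (\<lambda>m. poly (p m)) f sequentially"
    "\<And>x. (\<lambda>m. poly_op (p m) T x) \<longlonglongrightarrow> S x"
    using S unfolding is_cfc_def by blast
  show "R = S"
  proof
    fix x :: 'h
    have "(\<lambda>m. onorm (\<lambda>x. poly_op (p m) T x - R x) * norm x) \<longlonglongrightarrow> 0 * norm x"
      using R p(1) by (intro tendsto_intros) auto
    then have to0: "(\<lambda>m. onorm (\<lambda>x. poly_op (p m) T x - R x) * norm x) \<longlonglongrightarrow> 0"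
      by simp
    have "norm (poly_op (p m) T x - R x) \<le> onorm (\<lambda>x. poly_op (p m) T x - R x) * norm x" for m
      using onorm[OF pS[of R "p m"]] R by blast
    then have "(\<lambda>m. poly_op (p m) T x - R x) \<longlonglongrightarrow> 0"
      by (intro Lim_null_comparison[OF _ to0] always_eventually allI)
    then have "(\<lambda>m. poly_op (p m) T x) \<longlonglongrightarrow> R x"
      by (simp add: LIM_zero_iff)
    then show "R x = S x"
      using p(2) LIMSEQ_unique by blast
  qed
qed

text \<open>The spectrum of a positive operator lies in a compact subinterval of the half-line, on which
  \<open>f\<close> is a uniform limit of polynomials; the corresponding operators form a Cauchy sequence in
  operator norm.\<close>

lemma is_cfc_exists:
  fixes T :: "'h::chilbert_space \<Rightarrow> 'h"
  assumes T: "positive_op T" and f: "continuous_on {0..} f"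
  shows "\<exists>S. is_cfc f T S"
proof -
  note T' = positive_opD[OF T]
  have "continuous_on {0..onorm T} f"
    by (rule continuous_on_subset[OF f]) auto
  then obtain p where "uniform_limit {0..onorm T} (\<lambda>m. poly (p m)) f sequentially"
    using weierstrass_poly by blast
  then have p: "uniform_limit (real_spectrum T) (\<lambda>m. poly (p m)) f sequentially"
    by (rule uniform_limit_on_subset[OF _ real_spectrum_positive_op[OF T]])
  have bp: "bounded_clinear (poly_op (p m) T)" for m
    by (intro bounded_clinear_poly_op T')
  have close: "\<exists>N. \<forall>m\<ge>N. \<forall>n\<ge>N. \<forall>x. norm (poly_op (p m) T x - poly_op (p n) T x) \<le> e * norm x"
    if e: "e > 0" for e
  proof -
    obtain N where N: "\<And>m t. m \<ge> N \<Longrightarrow> t \<in> real_spectrum T \<Longrightarrow> dist (poly (p m) t) (f t) < e / 2"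
      using uniform_limitD[OF p half_gt_zero[OF e]] unfolding eventually_sequentially by blast
    have "\<bar>poly (p m) t - poly (p n) t\<bar> \<le> e" if "m \<ge> N" "n \<ge> N" "t \<in> real_spectrum T" for m n t
      using N[of m t] N[of n t] that unfolding dist_real_def by linarith
    then show ?thesis
      using norm_poly_op_diff_le[OF T] by blast
  qed
  have "convergent (\<lambda>m. poly_op (p m) T x)" for x
  proof (rule Cauchy_convergent, rule metric_CauchyI)
    fix e :: real assume e: "e > 0"
    have nx: "norm x + 1 > 0" using norm_ge_zero[of x] by linarith
    then obtain N where N: "\<And>m n. m \<ge> N \<Longrightarrow> n \<ge> N \<Longrightarrow>
        norm (poly_op (p m) T x - poly_op (p n) T x) \<le> e / (norm x + 1) * norm x"
      using close[of "e / (norm x + 1)"] e by auto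
    have "e / (norm x + 1) * norm x < e"
      using e nx by (simp add: field_simps)
    then have "dist (poly_op (p m) T x) (poly_op (p n) T x) < e" if "m \<ge> N" "n \<ge> N" for m n
      unfolding dist_norm by (rule le_less_trans[OF N[OF that]])
    then show "\<exists>N. \<forall>m\<ge>N. \<forall>n\<ge>N. dist (poly_op (p m) T x) (poly_op (p n) T x) < e"
      by blast
  qed
  then obtain S where S: "\<And>x. (\<lambda>m. poly_op (p m) T x) \<longlonglongrightarrow> S x"
    unfolding convergent_def by metis
  obtain N where N: "\<And>m n x. m \<ge> N \<Longrightarrow> n \<ge> N \<Longrightarrow>
      norm (poly_op (p m) T x - poly_op (p n) T x) \<le> 1 * norm x"
    using close[of 1] by auto
  obtain K where K: "\<And>x. norm (poly_op (p N) T x) \<le> norm x * K"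
    using bounded_linear.bounded[OF bounded_clinearD(1)[OF bp]] by blast
  have S_bound: "norm (S x) \<le> norm x * (K + 1)" for x
  proof (rule tendsto_upperbound)
    show "(\<lambda>m. norm (poly_op (p m) T x)) \<longlonglongrightarrow> norm (S x)"
      by (intro tendsto_intros S)
    show "\<forall>\<^sub>F m in sequentially. norm (poly_op (p m) T x) \<le> norm x * (K + 1)"
      using eventually_ge_at_top[of N]
    proof eventually_elim
      case (elim m)
      then show ?case
        using N[OF elim order_refl, of x] K[of x] norm_triangle_sub[of "poly_op (p m) T x" "poly_op (p N) T x"]
        by (simp add: algebra_simps)
    qed
  qed simp
  note linp = bounded_clinearD(2)[OF bp]
  have S_add: "S (x + y) = S x + S y" for x y
  proof (rule LIMSEQ_unique[OF S])
    show "(\<lambda>m. poly_op (p m) T (x + y)) \<longlonglongrightarrow> S x + S y"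
      unfolding linear_add[OF linp] by (intro tendsto_add S)
  qed
  have S_scaleC: "S (c *\<^sub>C x) = c *\<^sub>C S x" for c x
  proof (rule LIMSEQ_unique[OF S])
    show "(\<lambda>m. poly_op (p m) T (c *\<^sub>C x)) \<longlonglongrightarrow> c *\<^sub>C S x"
      unfolding bounded_clinearD(3)[OF bp]
      by (intro bounded_linear.tendsto[OF bounded_clinearD(1)[OF bounded_clinear_scaleC]] S)
  qed
  have "bounded_clinear S"
    unfolding bounded_clinear_def
    using S_add S_scaleC S_bound
    by (intro conjI allI bounded_linear_intro[where K = "K + 1"]) (auto simp: scaleR_scaleC)
  then show ?thesis
    using p S unfolding is_cfc_def by blast
qed

lemma is_cfc_cfc:
  assumes "positive_op T" "continuous_on {0..} f"
  shows "is_cfc f T (cfc f T)"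
  using is_cfc_exists[OF assms] cfc_eqI[OF assms(1)] by blast

lemma bounded_clinear_cfc:
  assumes "positive_op T" "continuous_on {0..} f"
  shows "bounded_clinear (cfc f T)"
  using is_cfc_cfc[OF assms] by (simp add: is_cfc_def)

lemma cfc_cong:
  assumes T: "positive_op T" and g: "continuous_on {0..} g" and fg: "\<And>t. t \<ge> 0 \<Longrightarrow> f t = g t"
  shows "cfc f T = cfc g T"
proof (rule cfc_eqI[OF T])
  have "f t = g t" if "t \<in> real_spectrum T" for t
    using real_spectrum_positive_op[OF T] that by (intro fg) auto
  then have "uniform_limit (real_spectrum T) h f F \<longleftrightarrow> uniform_limit (real_spectrum T) h g F"
    for h and F :: "nat filter"
    by (intro uniform_limit_cong') auto
  then show "is_cfc f T (cfc g T)"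
    using is_cfc_cfc[OF T g] by (simp add: is_cfc_def)
qed

lemma cfc_poly:
  assumes T: "positive_op T"
  shows "cfc (poly p) T = poly_op p T"
proof (rule cfc_eqI[OF T])
  show "is_cfc (poly p) T (poly_op p T)"
    unfolding is_cfc_def
    by (intro conjI bounded_clinear_poly_op positive_opD[OF T] exI[of _ "\<lambda>m. p"])
      (auto intro: uniform_limit_const)
qed

lemma cfc_ident:
  assumes "positive_op T"
  shows "cfc (\<lambda>t. t) T x = T x"
proof -
  have "(\<lambda>t. t) = poly [:0, 1::real:]" by (simp add: fun_eq_iff)
  then have "cfc (\<lambda>t. t) T = poly_op [:0, 1:] T" using cfc_poly[OF assms] by metis
  then show ?thesis
    using bounded_clinearD(2)[OF positive_opD(1)[OF assms]] by (simp add: poly_op_pCons linear_0)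
qed

lemma cfc_const:
  assumes "positive_op T"
  shows "cfc (\<lambda>t. c) T x = c *\<^sub>R x"
proof -
  have "(\<lambda>t. c) = poly [:c:]" by (simp add: fun_eq_iff)
  then have "cfc (\<lambda>t. c) T = poly_op [:c:] T" using cfc_poly[OF assms] by metis
  then show ?thesis
    using bounded_clinearD(2)[OF positive_opD(1)[OF assms]] by (simp add: poly_op_pCons linear_0)
qed

lemma cfc_add:
  assumes T: "positive_op T" and f: "continuous_on {0..} f" and g: "continuous_on {0..} g"
  shows "cfc (\<lambda>t. f t + g t) T x = cfc f T x + cfc g T x"
proof -
  obtain p where p: "uniform_limit (real_spectrum T) (\<lambda>m. poly (p m)) f sequentially"
    "\<And>x. (\<lambda>m. poly_op (p m) T x) \<longlonglongrightarrow> cfc f T x"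
    using is_cfc_cfc[OF T f] unfolding is_cfc_def by blast
  obtain q where q: "uniform_limit (real_spectrum T) (\<lambda>m. poly (q m)) g sequentially"
    "\<And>x. (\<lambda>m. poly_op (q m) T x) \<longlonglongrightarrow> cfc g T x"
    using is_cfc_cfc[OF T g] unfolding is_cfc_def by blast
  note lin = bounded_clinearD(2)[OF positive_opD(1)[OF T]]
  have "is_cfc (\<lambda>t. f t + g t) T (\<lambda>x. cfc f T x + cfc g T x)"
    unfolding is_cfc_def
  proof (intro conjI exI[of _ "\<lambda>m. p m + q m"] allI)
    have "(\<lambda>m. poly (p m + q m)) = (\<lambda>m t. poly (p m) t + poly (q m) t)"
      by (simp add: fun_eq_iff)
    then show "uniform_limit (real_spectrum T) (\<lambda>m. poly (p m + q m)) (\<lambda>t. f t + g t) sequentially"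
      using uniform_limit_add[OF p(1) q(1)] by metis
    show "(\<lambda>m. poly_op (p m + q m) T x) \<longlonglongrightarrow> cfc f T x + cfc g T x" for x
      unfolding poly_op_add[OF lin] by (intro tendsto_add p q)
  qed (intro bounded_clinear_add bounded_clinear_cfc assms)
  then show ?thesis by (simp add: cfc_eqI[OF T])
qed

lemma cfc_mult:
  assumes T: "positive_op T" and f: "continuous_on {0..} f" and g: "continuous_on {0..} g"
  shows "cfc (\<lambda>t. f t * g t) T x = cfc f T (cfc g T x)"
proof -
  obtain p where p: "uniform_limit (real_spectrum T) (\<lambda>m. poly (p m)) f sequentially"
    "\<And>x. (\<lambda>m. poly_op (p m) T x) \<longlonglongrightarrow> cfc f T x"
    using is_cfc_cfc[OF T f] unfolding is_cfc_def by blast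
  obtain q where q: "uniform_limit (real_spectrum T) (\<lambda>m. poly (q m)) g sequentially"
    "\<And>x. (\<lambda>m. poly_op (q m) T x) \<longlonglongrightarrow> cfc g T x"
    using is_cfc_cfc[OF T g] unfolding is_cfc_def by blast
  note T' = positive_opD[OF T]
  note lin = bounded_clinearD(2)[OF T'(1)]
  have bounded: "bounded (h ` real_spectrum T)" if "continuous_on {0..} h" for h :: "real \<Rightarrow> real"
  proof (rule bounded_subset)
    have "continuous_on {0..onorm T} h"
      by (rule continuous_on_subset[OF that]) auto
    then show "bounded (h ` {0..onorm T})"
      by (intro compact_imp_bounded compact_continuous_image compact_Icc)
    show "h ` real_spectrum T \<subseteq> h ` {0..onorm T}"
      by (rule image_mono[OF real_spectrum_positive_op[OF T]])
  qed
  have "is_cfc (\<lambda>t. f t * g t) T (\<lambda>x. cfc f T (cfc g T x))"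
    unfolding is_cfc_def
  proof (intro conjI exI[of _ "\<lambda>m. p m * q m"] allI)
    have "(\<lambda>m. poly (p m * q m)) = (\<lambda>m t. poly (p m) t * poly (q m) t)"
      by (simp add: fun_eq_iff)
    then show "uniform_limit (real_spectrum T) (\<lambda>m. poly (p m * q m)) (\<lambda>t. f t * g t) sequentially"
      using uniform_lim_mult[OF p(1) q(1) bounded[OF f] bounded[OF g]] by metis
    fix x
    \<comment> \<open>The operators \<open>p m (T)\<close> are eventually bounded by \<open>C + 1\<close>, so that they may be applied
      to the convergent sequence \<open>q m (T) x\<close>.\<close>
    obtain C where C: "\<And>t. t \<in> real_spectrum T \<Longrightarrow> \<bar>f t\<bar> \<le> C"
      using bounded[OF f] by (auto simp: bounded_iff)
    have ev: "\<forall>\<^sub>F m in sequentially. norm (poly_op (p m) T (poly_op (q m) T x - cfc g T x))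
        \<le> (C + 1) * norm (poly_op (q m) T x - cfc g T x)"
      using uniform_limitD[OF p(1), of 1, OF zero_less_one]
    proof eventually_elim
      case (elim m)
      show ?case
      proof (rule norm_poly_op_le[OF T'(1,2)])
        fix t assume "t \<in> real_spectrum T"
        then show "\<bar>poly (p m) t\<bar> \<le> C + 1"
          using elim C[of t] by (fastforce simp: dist_real_def)
      qed
    qed
    have "(\<lambda>m. (C + 1) * norm (poly_op (q m) T x - cfc g T x)) \<longlonglongrightarrow> (C + 1) * norm (cfc g T x - cfc g T x)"
      by (intro tendsto_intros q)
    then have "(\<lambda>m. poly_op (p m) T (poly_op (q m) T x - cfc g T x)) \<longlonglongrightarrow> 0"
      using Lim_null_comparison[OF ev] by simp
    from tendsto_add[OF this p(2)[of "cfc g T x"]]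
    show "(\<lambda>m. poly_op (p m * q m) T x) \<longlonglongrightarrow> cfc f T (cfc g T x)"
      using bounded_clinearD(2)[OF bounded_clinear_poly_op[OF T'(1)]]
      by (simp add: poly_op_mult[OF lin] linear_diff)
  qed (rule bounded_clinear_compose[OF bounded_clinear_cfc[OF T f] bounded_clinear_cfc[OF T g]])
  then show ?thesis by (simp add: cfc_eqI[OF T])
qed

lemma cfc_symmetric:
  assumes T: "positive_op T" and f: "continuous_on {0..} f"
  shows "inner (cfc f T x) y = inner x (cfc f T y)"
proof -
  obtain p where p: "\<And>x. (\<lambda>m. poly_op (p m) T x) \<longlonglongrightarrow> cfc f T x"
    using is_cfc_cfc[OF T f] unfolding is_cfc_def by blast
  note T' = positive_opD[OF T]
  have "(\<lambda>m. inner (poly_op (p m) T x) y) \<longlonglongrightarrow> inner (cfc f T x) y"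
    by (intro tendsto_intros p)
  moreover have "(\<lambda>m. inner x (poly_op (p m) T y)) \<longlonglongrightarrow> inner x (cfc f T y)"
    by (intro tendsto_intros p)
  ultimately show ?thesis
    using LIMSEQ_unique unfolding poly_op_symmetric[OF bounded_clinearD(2)[OF T'(1)] T'(2)] by blast
qed

text \<open>Positivity comes from \<open>f(T) = (sqrt f)(T)\<^sup>2\<close>.\<close>

lemma positive_op_cfc:
  assumes T: "positive_op T" and f: "continuous_on {0..} f" and nonneg: "\<And>t. t \<ge> 0 \<Longrightarrow> f t \<ge> 0"
  shows "positive_op (cfc f T)"
proof -
  have h: "continuous_on {0..} (\<lambda>t. sqrt (f t))"
    using f by (intro continuous_intros)
  have "0 \<le> inner (cfc f T x) x" for x
  proof -
    have eq: "cfc f T = cfc (\<lambda>t. sqrt (f t) * sqrt (f t)) T"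
    proof (rule cfc_cong[OF T])
      show "continuous_on {0..} (\<lambda>t. sqrt (f t) * sqrt (f t))"
        by (rule continuous_on_mult[OF h h])
    qed (simp add: nonneg)
    have "inner (cfc f T x) x = (norm (cfc (\<lambda>t. sqrt (f t)) T x))\<^sup>2"
      unfolding eq cfc_mult[OF T h h] power2_norm_eq_inner by (rule cfc_symmetric[OF T h])
    then show ?thesis by simp
  qed
  then show ?thesis
    unfolding positive_op_def by (simp add: bounded_clinear_cfc[OF T f] cfc_symmetric[OF T f])
qed

lemma norm_cfc_le:
  assumes T: "positive_op T" and f: "continuous_on {0..} f" and M: "\<And>t. t \<ge> 0 \<Longrightarrow> \<bar>f t\<bar> \<le> M"
  shows "norm (cfc f T x) \<le> M * norm x"
proof -
  have "norm (poly_op 0 T x - cfc f T x) \<le> M * norm x"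
  proof (rule is_cfc_approx[OF T is_cfc_cfc[OF T f]])
    fix t assume "t \<in> real_spectrum T"
    then have "t \<ge> 0" using real_spectrum_positive_op[OF T] by auto
    then show "\<bar>poly 0 t - f t\<bar> \<le> M" using M by simp
  qed
  then show ?thesis by simp
qed

lemma cfc_intertwine:
  assumes T: "positive_op T" and T': "positive_op T'" and X: "bounded_clinear X"
    and XT: "\<And>x. X (T x) = T' (X x)" and f: "continuous_on {0..} f"
  shows "X (cfc f T x) = cfc f T' (X x)"
proof -
  \<comment> \<open>One sequence of polynomials has to serve both operators.\<close>
  define K where "K = max (onorm T) (onorm T')"
  have "continuous_on {0..K} f"
    by (rule continuous_on_subset[OF f]) auto
  then obtain p where p: "uniform_limit {0..K} (\<lambda>m. poly (p m)) f sequentially"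
    using weierstrass_poly by blast
  have lim: "(\<lambda>m. poly_op (p m) R x) \<longlonglongrightarrow> cfc f R x" if R: "positive_op R" "onorm R \<le> K" for R x
  proof (rule Lim_transform2[OF tendsto_const], rule tendstoI)
    fix e :: real assume e: "e > 0"
    define e' where "e' = e / (norm x + 1)"
    have nx: "norm x + 1 > 0" using norm_ge_zero[of x] by linarith
    have e': "e' > 0" "e' * norm x < e"
      using e nx by (auto simp: e'_def field_simps)
    show "\<forall>\<^sub>F m in sequentially. dist (cfc f R x - poly_op (p m) R x) 0 < e"
      using uniform_limitD[OF p e'(1)]
    proof eventually_elim
      case (elim m)
      have "norm (poly_op (p m) R x - cfc f R x) \<le> e' * norm x"
      proof (rule is_cfc_approx[OF R(1) is_cfc_cfc[OF R(1) f]])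
        fix t assume "t \<in> real_spectrum R"
        then have "t \<in> {0..K}"
          using real_spectrum_positive_op[OF R(1)] R(2) by fastforce
        then show "\<bar>poly (p m) t - f t\<bar> \<le> e'"
          using elim by (auto simp: dist_real_def intro: less_imp_le)
      qed
      then show ?case using e'(2) by (simp add: norm_minus_commute)
    qed
  qed
  have "(\<lambda>m. X (poly_op (p m) T x)) \<longlonglongrightarrow> X (cfc f T x)"
    by (intro bounded_linear.tendsto[OF bounded_clinearD(1)[OF X]] lim T) (simp add: K_def)
  moreover have "X (poly_op (p m) T x) = poly_op (p m) T' (X x)" for m
    by (intro poly_op_intertwine bounded_clinearD(2) X XT positive_opD(1) T T')
  moreover have "(\<lambda>m. poly_op (p m) T' (X x)) \<longlonglongrightarrow> cfc f T' (X x)"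
    by (intro lim T') (simp add: K_def)
  ultimately show ?thesis
    using LIMSEQ_unique by simp
qed

section \<open>The absolute value and the mixed Schwarz inequality\<close>

lemma continuous_on_powr_halfline:
  "a > 0 \<Longrightarrow> continuous_on {0..} (\<lambda>t::real. t powr a)"
  by (intro continuous_on_powr' continuous_on_id continuous_on_const) auto

lemma positive_op_square:
  assumes "bounded_clinear F" and "\<And>x y. inner (F x) y = inner x (F y)"
  shows "positive_op (F ^^ 2)"
proof -
  have "F ^^ 2 = (\<lambda>x. F (F x))"
    by (simp add: numeral_2_eq_2 fun_eq_iff)
  moreover have "inner (F (F x)) x = (norm (F x))\<^sup>2" for x
    unfolding power2_norm_eq_inner by (rule assms(2))
  ultimately show ?thesis
    unfolding positive_op_def using bounded_clinear_compose[OF assms(1,1)] by (simp add: assms(2))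
qed

lemma positive_op_gram:
  assumes X: "bounded_clinear X"
  shows "positive_op (cadjoint X \<circ> X)"
proof -
  have "positive_op (\<lambda>x::'a. x)"
    by (simp add: positive_op_def bounded_clinear_id)
  from positive_op_conj[OF this X] show ?thesis by (simp add: comp_def)
qed

lemma positive_op_conj_cfc_square:
  assumes "positive_op T" "continuous_on {0..} f" "bounded_clinear B"
  shows "positive_op (cadjoint B \<circ> (cfc f T ^^ 2) \<circ> B)"
  by (intro positive_op_conj positive_op_square bounded_clinear_cfc cfc_symmetric assms)

lemma positive_op_abs:
  assumes "bounded_clinear X"
  shows "positive_op (op_abs X)"
  unfolding op_abs_def op_powr_def
  by (intro positive_op_cfc positive_op_gram assms continuous_on_powr_halfline) auto

lemma op_abs_op_abs:
  assumes X: "bounded_clinear X"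
  shows "op_abs X (op_abs X x) = cadjoint X (X x)"
proof -
  note T = positive_op_gram[OF X]
  have h: "continuous_on {0..} (\<lambda>t::real. t powr (1/2))"
    by (rule continuous_on_powr_halfline) simp
  have "cfc (\<lambda>t. t powr (1/2) * t powr (1/2)) (cadjoint X \<circ> X) = cfc (\<lambda>t. t) (cadjoint X \<circ> X)"
    by (rule cfc_cong[OF T continuous_on_id]) (simp add: powr_half_sqrt)
  then have "op_abs X (op_abs X x) = cfc (\<lambda>t. t) (cadjoint X \<circ> X) x"
    unfolding op_abs_def op_powr_def cfc_mult[OF T h h, symmetric] by simp
  then show ?thesis by (simp add: cfc_ident[OF T])
qed

lemma norm_op_abs:
  assumes X: "bounded_clinear X"
  shows "norm (op_abs X x) = norm (X x)"
proof -
  have "inner (op_abs X x) (op_abs X x) = inner x (op_abs X (op_abs X x))"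
    by (rule positive_opD(2)[OF positive_op_abs[OF X]])
  then show ?thesis
    by (simp add: norm_eq_sqrt_inner op_abs_op_abs[OF X] cadjoint_inner[OF X])
qed

lemma op_abs_intertwine:
  assumes X: "bounded_clinear X"
  shows "X (op_abs X x) = op_abs (cadjoint X) (X x)"
  unfolding op_abs_def op_powr_def
  by (intro cfc_intertwine positive_op_gram X bounded_clinear_cadjoint continuous_on_powr_halfline)
    (simp_all add: cadjoint_cadjoint[OF X])

text \<open>The contractions \<open>U = X (\<bar>X\<bar> + \<epsilon>)\<^sup>-\<^sup>1\<close> replace the partial isometry of the polar
  decomposition: \<open>U \<bar>X\<bar>\<close> differs from \<open>X\<close> by at most \<open>\<epsilon>\<close> in norm, and \<open>U h(\<bar>X\<bar>) = h(\<bar>X\<^sup>*\<bar>) U\<close>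
  for every continuous \<open>h\<close>. Hence \<open>\<langle>X x, y\<rangle>\<close> is, up to \<open>\<epsilon>\<close>,
  \<open>\<langle>U g(\<bar>X\<bar>) f(\<bar>X\<bar>) x, y\<rangle> = \<langle>U f(\<bar>X\<bar>) x, g(\<bar>X\<^sup>*\<bar>) y\<rangle>\<close>.\<close>

lemma mixed_schwarz:
  fixes X :: "'h::chilbert_space \<Rightarrow> 'h"
  assumes X: "bounded_clinear X"
    and f: "continuous_on {0..} f" and g: "continuous_on {0..} g"
    and fg: "\<And>t. t \<ge> 0 \<Longrightarrow> f t * g t = t"
  shows "cmod (cinner (X x) y) \<le> norm (cfc f (op_abs X) x) * norm (cfc g (op_abs (cadjoint X)) y)"
proof (rule field_le_epsilon)
  fix d :: real assume d: "d > 0"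
  define A where "A = op_abs X"
  define B where "B = op_abs (cadjoint X)"
  have A: "positive_op A" unfolding A_def by (rule positive_op_abs[OF X])
  have B: "positive_op B" unfolding B_def by (intro positive_op_abs bounded_clinear_cadjoint X)
  have norm_A: "norm (A z) = norm (X z)" for z unfolding A_def by (rule norm_op_abs[OF X])
  define \<epsilon> where "\<epsilon> = d / (norm x * norm y + 1)"
  have den: "norm x * norm y + 1 > 0" by (simp add: add_nonneg_pos)
  have eps: "\<epsilon> > 0" "\<epsilon> * (norm x * norm y) \<le> d"
    using d den by (auto simp: \<epsilon>_def field_simps)
  define h where "h t = 1 / (t + \<epsilon>)" for t :: real
  have cont: "continuous_on {0..} h" "continuous_on {0..} (\<lambda>t. \<epsilon> * h t)"
    "continuous_on {0..} (\<lambda>t. t * h t)" "continuous_on {0..} (\<lambda>t. t * (\<epsilon> * h t))"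
    "continuous_on {0..} (\<lambda>t. h t * t)"
    unfolding h_def using eps by (auto intro!: continuous_intros)
  have id: "cfc (\<lambda>t. t) A z = A z" for z by (rule cfc_ident[OF A])
  define U where "U z = X (cfc h A z)" for z
  have U_le: "norm (U z) \<le> norm z" for z
  proof -
    have "norm (U z) = norm (cfc (\<lambda>t. t * h t) A z)"
      by (simp add: U_def norm_A[symmetric] cfc_mult[OF A continuous_on_id cont(1)] id)
    also have "\<dots> \<le> 1 * norm z"
      by (rule norm_cfc_le[OF A cont(3)]) (use eps in \<open>simp add: h_def\<close>)
    finally show ?thesis by simp
  qed
  have U_abs: "norm (X z - U (A z)) \<le> \<epsilon> * norm z" for z
  proof -
    have "cfc (\<lambda>t. h t * t + \<epsilon> * h t) A = cfc (\<lambda>t. 1) A"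
    proof (rule cfc_cong[OF A continuous_on_const])
      fix t :: real assume "t \<ge> 0"
      then have "t + \<epsilon> \<noteq> 0" using eps by simp
      then show "h t * t + \<epsilon> * h t = 1"
        by (simp add: h_def add_divide_distrib[symmetric])
    qed
    then have "z = cfc h A (A z) + cfc (\<lambda>t. \<epsilon> * h t) A z"
      using cfc_add[OF A cont(5) cont(2), of z] cfc_mult[OF A cont(1) continuous_on_id, of z]
        cfc_const[OF A, of 1 z] by (simp add: id)
    then have "X z - U (A z) = X (cfc (\<lambda>t. \<epsilon> * h t) A z)"
      by (metis U_def add_diff_cancel_left' bounded_clinearD(2)[OF X] linear_diff)
    then have "norm (X z - U (A z)) = norm (cfc (\<lambda>t. t * (\<epsilon> * h t)) A z)"
      by (simp add: norm_A[symmetric] cfc_mult[OF A continuous_on_id cont(2)] id)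
    also have "\<dots> \<le> \<epsilon> * norm z"
      by (rule norm_cfc_le[OF A cont(4)]) (use eps in \<open>simp add: h_def field_simps\<close>)
    finally show ?thesis .
  qed
  have "U (A x) = cfc g B (U (cfc f A x))"
  proof -
    have "cfc (\<lambda>t. g t * f t) A = cfc (\<lambda>t. t) A"
      by (rule cfc_cong[OF A continuous_on_id]) (simp add: fg mult.commute)
    then have "A x = cfc g A (cfc f A x)"
      using cfc_mult[OF A g f, of x] by (simp add: id)
    moreover have "cfc h A (cfc g A z) = cfc g A (cfc h A z)" for z
      by (simp add: cfc_mult[OF A cont(1) g, symmetric] cfc_mult[OF A g cont(1), symmetric]
          mult.commute)
    moreover have "X (cfc g A z) = cfc g B (X z)" for z
      by (rule cfc_intertwine[OF A B X _ g]) (simp add: A_def B_def op_abs_intertwine[OF X])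
    ultimately show ?thesis by (simp add: U_def)
  qed
  then have "cinner (U (A x)) y = cinner (U (cfc f A x)) (cfc g B y)"
    by (simp add: cinner_symmetric[OF bounded_clinear_cfc[OF B g] cfc_symmetric[OF B g]])
  also have "cmod \<dots> \<le> norm (U (cfc f A x)) * norm (cfc g B y)"
    by (rule cmod_cinner_le)
  also have "\<dots> \<le> norm (cfc f A x) * norm (cfc g B y)"
    by (intro mult_right_mono U_le) simp
  finally have main: "cmod (cinner (U (A x)) y) \<le> norm (cfc f A x) * norm (cfc g B y)" .
  have "cmod (cinner (X x - U (A x)) y) \<le> norm (X x - U (A x)) * norm y"
    by (rule cmod_cinner_le)
  also have "\<dots> \<le> \<epsilon> * norm x * norm y"
    by (intro mult_right_mono U_abs) simp
  also have "\<dots> \<le> d" using eps(2) by (simp add: mult.assoc)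
  finally have "cmod (cinner (X x - U (A x)) y) \<le> d" .
  moreover have "cinner (X x) y = cinner (U (A x)) y + cinner (X x - U (A x)) y"
    by (simp add: cinner_add_left[symmetric])
  ultimately have "cmod (cinner (X x) y) \<le> norm (cfc f A x) * norm (cfc g B y) + d"
    using main norm_triangle_le[of "cinner (U (A x)) y" "cinner (X x - U (A x)) y"] by simp
  then show "cmod (cinner (X x) y)
      \<le> norm (cfc f (op_abs X) x) * norm (cfc g (op_abs (cadjoint X)) y) + d"
    unfolding A_def B_def .
qed

section \<open>Power inequalities\<close>

lemma young_weighted:
  fixes a b :: real
  assumes "0 < \<nu>" "\<nu> < 1" "0 \<le> a" "0 \<le> b"
  shows "a powr \<nu> * b powr (1 - \<nu>) \<le> \<nu> * a + (1 - \<nu>) * b"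
  using assms Youngs_inequality_0[of \<nu> "1 - \<nu>" a b] by (cases "a = 0 \<or> b = 0") auto

text \<open>The tangent of \<open>t powr s\<close> at \<open>a\<close>, cleared of fractions; it is Young's inequality for the
  conjugate exponents \<open>s\<close> and \<open>s / (s - 1)\<close>.\<close>

lemma powr_above_tangent:
  fixes a t s :: real
  assumes "0 \<le> a" "0 \<le> t" "1 \<le> s"
  shows "s * (a powr (s - 1) * t) \<le> t powr s + (s - 1) * a powr s"
proof (cases "s = 1 \<or> a = 0 \<or> t = 0")
  case False
  then have pos: "a > 0" "t > 0" "s > 1" using assms by auto
  have "(t powr s) powr (1/s) * (a powr s) powr (1 - 1/s) \<le> 1/s * t powr s + (1 - 1/s) * a powr s"
    using pos by (intro young_weighted) auto
  moreover have "s * (1 - 1/s) = s - 1" using pos by (simp add: field_simps)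
  ultimately have "t * a powr (s - 1) \<le> 1/s * t powr s + (1 - 1/s) * a powr s"
    using pos by (simp add: powr_powr)
  then have "s * (t * a powr (s - 1)) \<le> s * (1/s * t powr s + (1 - 1/s) * a powr s)"
    using pos by (intro mult_left_mono) auto
  moreover have "s * (1/s * t powr s + (1 - 1/s) * a powr s) = t powr s + (s - 1) * a powr s"
    using pos by (simp add: field_simps)
  ultimately show ?thesis
    by (simp add: mult.commute)
qed (use assms in auto)

text \<open>McCarthy's inequality: apply the functional calculus to the tangent of \<open>t powr s\<close> at
  \<open>\<langle>T x, x\<rangle>\<close>.\<close>

lemma mccarthy:
  assumes T: "positive_op T" and s: "1 \<le> s" and x: "norm x = 1"
  shows "inner (T x) x powr s \<le> inner (op_powr T s x) x"
proof -
  define a where "a = inner (T x) x"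
  have a: "0 \<le> a" unfolding a_def by (rule positive_opD(3)[OF T])
  define c where "c = - (s * a powr (s - 1))"
  have cont: "continuous_on {0..} (\<lambda>t::real. t powr s)" "continuous_on {0..} (\<lambda>t::real. c * t)"
    "continuous_on {0..} (\<lambda>t::real. c * t + (s - 1) * a powr s)"
    "continuous_on {0..} (\<lambda>t::real. t powr s + (c * t + (s - 1) * a powr s))"
    using s by (auto intro!: continuous_on_powr_halfline continuous_intros)
  have "positive_op (cfc (\<lambda>t. t powr s + (c * t + (s - 1) * a powr s)) T)"
    using powr_above_tangent[OF a _ s]
    by (intro positive_op_cfc[OF T cont(4)]) (simp add: c_def algebra_simps)
  then have "0 \<le> inner (cfc (\<lambda>t. t powr s + (c * t + (s - 1) * a powr s)) T x) x"
    by (rule positive_opD)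
  also have "cfc (\<lambda>t. t powr s + (c * t + (s - 1) * a powr s)) T x
      = op_powr T s x + (c *\<^sub>R T x + ((s - 1) * a powr s) *\<^sub>R x)"
    using cfc_add[OF T cont(1,3)] cfc_add[OF T cont(2) continuous_on_const, of "(s - 1) * a powr s"]
      cfc_mult[OF T continuous_on_const continuous_on_id, of c] cfc_const[OF T] cfc_ident[OF T]
    by (simp add: op_powr_def)
  finally have "0 \<le> inner (op_powr T s x) x + (c * a + (s - 1) * a powr s)"
    using x by (simp add: inner_simps a_def[symmetric] norm_eq_1)
  moreover have "a powr (s - 1) * a = a powr s"
    using a powr_mult_base[of a "s - 1"] by (cases "a = 0") (auto simp: mult.commute)
  then have "c * a = - (s * a powr s)"
    by (simp add: c_def mult.assoc)
  ultimately show ?thesis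
    unfolding a_def[symmetric] by (simp add: left_diff_distrib)
qed

text \<open>Convexity of \<open>t powr r\<close>, in the form that every point lies above the tangent at the mean
  \<open>m\<close>: summing over the index set makes the linear terms cancel.\<close>

lemma powr_sum_le:
  fixes a :: "'i \<Rightarrow> real"
  assumes I: "finite I" "I \<noteq> {}" and a: "\<And>i. i \<in> I \<Longrightarrow> 0 \<le> a i" and r: "1 \<le> r"
  shows "(\<Sum>i\<in>I. a i) powr r \<le> real (card I) powr (r - 1) * (\<Sum>i\<in>I. a i powr r)"
proof -
  define N where "N = real (card I)"
  have N: "N > 0" using I by (simp add: N_def card_gt_0_iff)
  define m where "m = (\<Sum>i\<in>I. a i) / N"
  have m: "0 \<le> m" using N a by (simp add: m_def sum_nonneg)
  have sum: "(\<Sum>i\<in>I. a i) = N * m" using N by (simp add: m_def)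
  have pm: "m powr (r - 1) * m = m powr r"
    using m powr_mult_base[of m "r - 1"] by (cases "m = 0") (auto simp: mult.commute)
  have "(\<Sum>i\<in>I. r * (m powr (r - 1) * a i)) \<le> (\<Sum>i\<in>I. a i powr r + (r - 1) * m powr r)"
    by (intro sum_mono powr_above_tangent m a r)
  then have "r * (m powr (r - 1) * (N * m)) \<le> (\<Sum>i\<in>I. a i powr r) + N * ((r - 1) * m powr r)"
    by (simp add: sum.distrib sum_distrib_left[symmetric] sum N_def)
  then have "N * m powr r \<le> (\<Sum>i\<in>I. a i powr r)"
    unfolding pm[symmetric] by (simp add: algebra_simps)
  then have "N powr (r - 1) * (N * m powr r) \<le> N powr (r - 1) * (\<Sum>i\<in>I. a i powr r)"
    by (intro mult_left_mono) auto
  moreover have "N powr (r - 1) * (N * m powr r) = (N * m) powr r"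
    using N m powr_mult_base[of N "r - 1"] by (simp add: powr_mult mult_ac)
  ultimately show ?thesis unfolding sum N_def[symmetric] by simp
qed

section \<open>Berezin number estimates\<close>

lemma norm_normalized_kernel:
  assumes "rkhs \<Omega> ev" "w \<in> \<Omega>"
  shows "norm (normalized_kernel ev w) = 1"
  using rkhs.rep_kernel_nonzero[OF assms] by (simp add: normalized_kernel_def)

lemma cmod_le_ber:
  fixes T :: "'h::chilbert_space \<Rightarrow> 'h"
  assumes H: "rkhs \<Omega> ev" and T: "bounded_clinear T" and w: "w \<in> \<Omega>"
  shows "cmod (cinner (T (normalized_kernel ev w)) (normalized_kernel ev w)) \<le> ber \<Omega> ev T"
  unfolding ber_def
proof (rule cSUP_upper[OF w], rule bdd_aboveI2)
  fix v assume "v \<in> \<Omega>"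
  then have k: "norm (normalized_kernel ev v) = 1"
    by (rule norm_normalized_kernel[OF H])
  show "cmod (cinner (T (normalized_kernel ev v)) (normalized_kernel ev v)) \<le> onorm T"
    using cmod_cinner_le[of "T (normalized_kernel ev v)" "normalized_kernel ev v"]
      onorm[OF bounded_clinearD(1)[OF T], of "normalized_kernel ev v"] k by simp
qed

text \<open>With \<open>u = norm (f(\<bar>X\<bar>) B k)\<close> and
  \<open>v = norm (g(\<bar>X\<^sup>*\<bar>) A k)\<close>, the mixed Schwarz inequality bounds the left side by
  \<open>(u\<^sup>2) powr (r/2) * (v\<^sup>2) powr (r/2)\<close>. Young's inequality separates the two factors, and
  McCarthy's inequality moves the exponents, which are at least one, inside the inner products
  \<open>u\<^sup>2\<close> and \<open>v\<^sup>2\<close>.\<close>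

lemma cmod_summand_powr_le:
  fixes A B X :: "'h::chilbert_space \<Rightarrow> 'h"
  assumes A: "bounded_clinear A" and B: "bounded_clinear B" and X: "bounded_clinear X"
    and f: "continuous_on {0..} f" and g: "continuous_on {0..} g"
    and fg: "\<And>t. t \<ge> 0 \<Longrightarrow> f t * g t = t"
    and \<nu>: "0 < \<nu>" "\<nu> < 1" and r: "r \<ge> 2 * \<nu>" "r \<ge> 2 * (1 - \<nu>)"
    and k: "norm k = 1"
  defines "P \<equiv> cadjoint B \<circ> (cfc f (op_abs X) ^^ 2) \<circ> B"
    and "Q \<equiv> cadjoint A \<circ> (cfc g (op_abs (cadjoint X)) ^^ 2) \<circ> A"
  shows "cmod (cinner ((cadjoint A \<circ> X \<circ> B) k) k) powr r
      \<le> \<nu> * inner (op_powr P (r / (2 * \<nu>)) k) k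
        + (1 - \<nu>) * inner (op_powr Q (r / (2 * (1 - \<nu>))) k) k"
proof -
  define F where "F = cfc f (op_abs X)"
  define G where "G = cfc g (op_abs (cadjoint X))"
  note X' = bounded_clinear_cadjoint[OF X]
  have F: "bounded_clinear F" "inner (F x) y = inner x (F y)" for x y
    unfolding F_def by (intro bounded_clinear_cfc cfc_symmetric positive_op_abs X f)+
  have G: "bounded_clinear G" "inner (G x) y = inner x (G y)" for x y
    unfolding G_def by (intro bounded_clinear_cfc cfc_symmetric positive_op_abs X' g)+
  have P: "positive_op P" and Q: "positive_op Q"
    unfolding P_def Q_def by (intro positive_op_conj_cfc_square positive_op_abs X X' f g A B)+
  have adj: "inner (cadjoint S x) y = inner x (S y)" if "bounded_clinear S" for S :: "'h \<Rightarrow> 'h" and x y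
    using cadjoint_inner[OF that] by (metis inner_commute)
  define u v where "u = norm (F (B k))" and "v = norm (G (A k))"
  have uv: "0 \<le> u" "0 \<le> v" by (auto simp: u_def v_def)
  have P_k: "inner (P k) k = u\<^sup>2"
    unfolding P_def F_def[symmetric] u_def power2_norm_eq_inner
    by (simp add: adj[OF B] F(2) numeral_2_eq_2)
  have Q_k: "inner (Q k) k = v\<^sup>2"
    unfolding Q_def G_def[symmetric] v_def power2_norm_eq_inner
    by (simp add: adj[OF A] G(2) numeral_2_eq_2)
  have "cinner ((cadjoint A \<circ> X \<circ> B) k) k = cinner (X (B k)) (A k)"
    using cadjoint_cinner[OF A, of k "X (B k)"] by (metis cinner_commute comp_apply)
  then have "cmod (cinner ((cadjoint A \<circ> X \<circ> B) k) k) \<le> u * v"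
    using mixed_schwarz[OF X f g fg, of "B k" "A k"] by (simp add: u_def v_def F_def G_def)
  then have "cmod (cinner ((cadjoint A \<circ> X \<circ> B) k) k) powr r \<le> (u * v) powr r"
    using \<nu> r by (intro powr_mono2) auto
  also have "\<dots> = ((u\<^sup>2) powr (r / (2 * \<nu>))) powr \<nu>
      * ((v\<^sup>2) powr (r / (2 * (1 - \<nu>)))) powr (1 - \<nu>)"
  proof -
    have pow: "((z\<^sup>2) powr (r / (2 * \<mu>))) powr \<mu> = z powr r" if "z \<ge> 0" "\<mu> \<noteq> 0" for z \<mu> :: real
      using that by (cases "z = 0") (auto simp: powr_powr simp flip: powr_numeral)
    have "((u\<^sup>2) powr (r / (2 * \<nu>))) powr \<nu> = u powr r"
      by (rule pow) (use uv \<nu> in auto)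
    moreover have "((v\<^sup>2) powr (r / (2 * (1 - \<nu>)))) powr (1 - \<nu>) = v powr r"
      by (rule pow) (use uv \<nu> in auto)
    ultimately show ?thesis by (simp only: powr_mult uv)
  qed
  also have "\<dots> \<le> \<nu> * (u\<^sup>2) powr (r / (2 * \<nu>)) + (1 - \<nu>) * (v\<^sup>2) powr (r / (2 * (1 - \<nu>)))"
    by (intro young_weighted \<nu>) auto
  also have "\<dots> \<le> \<nu> * inner (op_powr P (r / (2 * \<nu>)) k) k
      + (1 - \<nu>) * inner (op_powr Q (r / (2 * (1 - \<nu>))) k) k"
    unfolding P_k[symmetric] Q_k[symmetric]
    using \<nu> r by (intro add_mono mult_left_mono mccarthy P Q k) auto
  finally show "cmod (cinner ((cadjoint A \<circ> X \<circ> B) k) k) powr r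
      \<le> \<nu> * inner (op_powr P (r / (2 * \<nu>)) k) k
        + (1 - \<nu>) * inner (op_powr Q (r / (2 * (1 - \<nu>))) k) k" .
qed

lemma add_le_sqrt2_cmod: "a + b \<le> sqrt 2 * cmod (Complex a b)"
proof -
  have "(a + b)\<^sup>2 \<le> 2 * (a\<^sup>2 + b\<^sup>2)"
    using zero_le_power2[of "a - b"] by (simp add: power2_eq_square algebra_simps)
  then have "\<bar>a + b\<bar> \<le> sqrt (2 * (a\<^sup>2 + b\<^sup>2))"
    by (metis real_sqrt_abs real_sqrt_le_mono)
  then show ?thesis unfolding complex_norm real_sqrt_mult by linarith
qed

theorem theorem2p18:
  fixes \<Omega> :: "'w set" and ev :: "'h::chilbert_space \<Rightarrow> 'w \<Rightarrow> complex"
    and A B X :: "nat \<Rightarrow> 'h \<Rightarrow> 'h"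
    and f g :: "real \<Rightarrow> real"
    and n :: nat and \<nu> r :: real
  assumes "rkhs \<Omega> ev"
    and "n \<ge> 1"
    and "\<And>i. i \<in> {1..n} \<Longrightarrow> bounded_clinear (A i)"
    and "\<And>i. i \<in> {1..n} \<Longrightarrow> bounded_clinear (B i)"
    and "\<And>i. i \<in> {1..n} \<Longrightarrow> bounded_clinear (X i)"
    and "continuous_on {0..} f" and "continuous_on {0..} g"
    and "\<And>t. t \<ge> 0 \<Longrightarrow> f t \<ge> 0" and "\<And>t. t \<ge> 0 \<Longrightarrow> g t \<ge> 0"
    and "\<And>t. t \<ge> 0 \<Longrightarrow> f t * g t = t"
    and "0 < \<nu>" and "\<nu> < 1"
    and "r \<ge> 2 * max \<nu> (1 - \<nu>)"
  shows "ber \<Omega> ev (\<lambda>x. \<Sum>i=1..n. (cadjoint (A i) \<circ> X i \<circ> B i) x) powr r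
    \<le> sqrt 2 * real n powr (r - 1) *
      ber \<Omega> ev (\<lambda>x. \<Sum>i=1..n.
        \<nu> *\<^sub>R op_powr (cadjoint (B i) \<circ> (cfc f (op_abs (X i)) ^^ 2) \<circ> B i) (r / (2 * \<nu>)) x
        + (\<i> * complex_of_real (1 - \<nu>)) *\<^sub>C
            op_powr (cadjoint (A i) \<circ> (cfc g (op_abs (cadjoint (X i))) ^^ 2) \<circ> A i)
              (r / (2 * (1 - \<nu>))) x)"
proof -
  note H = assms(1) and bounded = assms(3-5) and cont = assms(6,7) and fg = assms(10)
    and \<nu> = assms(11,12)
  have r: "r \<ge> 2 * \<nu>" "r \<ge> 2 * (1 - \<nu>)" "r \<ge> 1"
    using assms(13) by (auto simp: max_def split: if_splits)
  define P where "P i = cadjoint (B i) \<circ> (cfc f (op_abs (X i)) ^^ 2) \<circ> B i" for i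
  define Q where "Q i = cadjoint (A i) \<circ> (cfc g (op_abs (cadjoint (X i))) ^^ 2) \<circ> A i" for i
  define P' where "P' i = op_powr (P i) (r / (2 * \<nu>))" for i
  define Q' where "Q' i = op_powr (Q i) (r / (2 * (1 - \<nu>)))" for i
  define L where "L x = (\<Sum>i=1..n. (cadjoint (A i) \<circ> X i \<circ> B i) x)" for x
  define M where "M x = (\<Sum>i=1..n. \<nu> *\<^sub>R P' i x + (\<i> * complex_of_real (1 - \<nu>)) *\<^sub>C Q' i x)" for x
  define C where "C = sqrt 2 * real n powr (r - 1) * ber \<Omega> ev M"
  obtain w0 where w0: "w0 \<in> \<Omega>" using rkhs.nonempty[OF H] by blast
  have P': "positive_op (P' i)" and Q': "positive_op (Q' i)" if "i \<in> {1..n}" for i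
    unfolding P'_def Q'_def P_def Q_def op_powr_def using \<nu> r that
    by (auto intro!: positive_op_cfc positive_op_conj_cfc_square positive_op_abs
        bounded_clinear_cadjoint bounded cont continuous_on_powr_halfline)
  have L: "bounded_clinear L"
    unfolding L_def comp_def
    by (intro bounded_clinear_sum bounded_clinear_compose[OF bounded_clinear_cadjoint[OF bounded(1)]]
        bounded_clinear_compose[OF bounded(3)] bounded(2))
  have M: "bounded_clinear M"
    unfolding M_def
    by (intro bounded_clinear_sum bounded_clinear_add
        bounded_clinear_compose[OF bounded_clinear_scaleR] bounded_clinear_compose[OF bounded_clinear_scaleC]
        positive_opD(1)[OF P'] positive_opD(1)[OF Q'])
  have main: "cmod (cinner (L k) k) powr r \<le> C" if w: "w \<in> \<Omega>" and k_def: "k = normalized_kernel ev w" for w k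
  proof -
    have k: "norm k = 1"
      unfolding k_def by (rule norm_normalized_kernel[OF H w])
    define a where "a = (\<Sum>i=1..n. \<nu> * inner (P' i k) k)"
    define b where "b = (\<Sum>i=1..n. (1 - \<nu>) * inner (Q' i k) k)"
    define l where "l i = cmod (cinner ((cadjoint (A i) \<circ> X i \<circ> B i) k) k)" for i
    have "cmod (cinner (L k) k) \<le> (\<Sum>i=1..n. l i)"
      unfolding L_def l_def cinner_sum_left by (rule norm_sum)
    then have "cmod (cinner (L k) k) powr r \<le> (\<Sum>i=1..n. l i) powr r"
      using r(3) by (intro powr_mono2) auto
    also have "\<dots> \<le> real n powr (r - 1) * (\<Sum>i=1..n. l i powr r)"
      using powr_sum_le[of "{1..n}" l r] assms(2) r(3) by (simp add: l_def)
    also have "\<dots> \<le> real n powr (r - 1) * (a + b)"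
      unfolding a_def b_def sum.distrib[symmetric]
    proof (intro mult_left_mono sum_mono)
      fix i assume i: "i \<in> {1..n}"
      show "l i powr r \<le> \<nu> * inner (P' i k) k + (1 - \<nu>) * inner (Q' i k) k"
        unfolding l_def P'_def Q'_def P_def Q_def
        by (rule cmod_summand_powr_le[OF bounded[OF i] cont fg \<nu> r(1,2) k])
    qed simp
    also have "\<dots> \<le> real n powr (r - 1) * (sqrt 2 * cmod (Complex a b))"
      by (intro mult_left_mono add_le_sqrt2_cmod) auto
    also have "Complex a b = cinner (M k) k"
    proof -
      have "cinner (M k) k = (\<Sum>i=1..n. of_real (\<nu> * inner (P' i k) k)
          + \<i> * of_real ((1 - \<nu>) * inner (Q' i k) k))"
        unfolding M_def cinner_sum_left
        by (intro sum.cong refl)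
          (simp add: cinner_add_left cinner_scaleR_left cinner_scaleC_left cinner_positive_op P' Q' mult.assoc)
      also have "\<dots> = of_real a + \<i> * of_real b"
        by (simp add: a_def b_def sum.distrib sum_distrib_left)
      finally show ?thesis by (simp add: Complex_eq)
    qed
    also have "real n powr (r - 1) * (sqrt 2 * cmod (cinner (M k) k)) \<le> C"
      unfolding C_def using cmod_le_ber[OF H M w, folded k_def]
      by (simp add: mult_ac mult_right_mono)
    finally show ?thesis .
  qed
  have "ber \<Omega> ev L \<le> C powr (1 / r)"
    unfolding ber_def
  proof (rule cSUP_least[OF rkhs.nonempty[OF H]])
    fix w assume "w \<in> \<Omega>"
    define l where "l = cmod (cinner (L (normalized_kernel ev w)) (normalized_kernel ev w))"
    have "(l powr r) powr (1 / r) \<le> C powr (1 / r)"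
      unfolding l_def using main[OF \<open>w \<in> \<Omega>\<close> refl] r(3) by (intro powr_mono2) auto
    then show "l \<le> C powr (1 / r)"
      using r(3) by (simp add: powr_powr l_def)
  qed
  moreover have "0 \<le> ber \<Omega> ev L"
    using cmod_le_ber[OF H L w0] norm_ge_zero order_trans by blast
  ultimately have "ber \<Omega> ev L powr r \<le> (C powr (1 / r)) powr r"
    using r(3) by (intro powr_mono2) auto
  also have "\<dots> = C"
    using r(3) main[OF w0 refl] order_trans[OF powr_ge_zero] by (simp add: powr_powr)
  finally show ?thesis
    unfolding C_def L_def M_def P'_def Q'_def P_def Q_def .
qed

end
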